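(* Let $S\in C^1(Z)$, let $W$ be some vector field on $Z$ and $\mathbf{F}$ a vector field on $Z$. Let $\mathcal{H}=\mathcal{H}_1+\mathcal{H}_2$ with $\mathcal{H}_i:T^*Z\to\mathbb{R}$ and $\mathcal{H}_1(z,\xi)=\langle W(z),\xi\rangle$, and let $\Psi^*:T^*Z\to[0,\infty)$ be related to $\mathcal{H}_2$ by $$(\ast)\qquad \Psi^*(z,\xi)=\mathcal{H}_2\bigl(z,\xi+\tfrac12\mathrm{d}S(z)\bigr)-\mathcal{H}_2\bigl(z,\tfrac12\mathrm{d}S(z)\bigr),\qquad \mathcal{H}_2(z,\xi)=\Psi^*\bigl(z,\xi-\tfrac12\mathrm{d}S(z)\bigr)-\Psi^*\bigl(z,-\tfrac12\mathrm{d}S(z)\bigr),$$ with $\Psi$ the Legendre dual of $\Psi^*$ and $\mathcal{L}$ the Legendre dual of $\mathcal{H}$. On $\widehat{Z}:=Z\times\mathbb{R}$, with points $(z,a)$, define $\widehat{\mathbf{F}}=(\mathbf{F},0)$, $\widehat{S}(z,a)=S(z)$, $\widehat{E}(z,a)=a$, $$\widehat{\Psi}^*\left(\begin{pmatrix}z \\ a\end{pmatrix},\begin{pmatrix}\xi \\ r\end{pmatrix}\right)=\Psi^*(z,\xi),\qquad \widehat{\mathcal{H}}_i\left(\begin{pmatrix}z \\ a\end{pmatrix},\begin{pmatrix}\xi \\ r\end{pmatrix}\right)=\mathcal{H}_i(z,\xi),\quad i\in\{1,2\},$$ $$\widehat{L}(z,a)\begin{pmatrix}\xi \\ r\end{pmatrix}=\begin{pmatrix}r\,W(z)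 \\ -\langle W(z),\xi\rangle\end{pmatrix}=\begin{pmatrix}0 & W(z) \\ -W(z) & 0\end{pmatrix}\begin{pmatrix}\xi \\ r\end{pmatrix},$$ let $\widehat{\Psi}$ be the Legendre dual of $\widehat{\Psi}^*$, $\widehat{\mathcal{H}}=\widehat{\mathcal{H}}_1+\widehat{\mathcal{H}}_2$, and $\widehat{\mathcal{L}}$ the Legendre dual of $\widehat{\mathcal{H}}$. Then: (i) $\widehat{\Psi}^*$ and $\widehat{\mathcal{H}}_2$ are related to each other by the relations $(\ast)$ with $S$ replaced by $\widehat{S}$. (ii) $\widehat{L}$ is anti-symmetric and satisfies the Jacobi identity. (iii) If $\langle W(z),\mathrm{d}S(z)\rangle=0$, then $\widehat{L}\,\mathrm{d}\widehat{S}=0$. (a) Suppose $\langle W,\mathrm{d}S\rangle=0$ on $Z$, $\mathcal{H}_2$ is reversible with respect to $S$ and $\mathbf{F}$ is the zero-cost flow for $\mathcal{L}$. Then $\widehat{\mathcal{H}}_1$ is the linear pairing with $\widehat{L}\,\mathrm{d}\widehat{E}$, $\widehat{\mathcal{H}}_2$ is reversible with respect to $\widehat{S}$, $\widehat{L}\,\mathrm{d}\widehat{S}=0$, the map $\alpha\mapsto\widehat{\mathcal{H}}_2\bigl((z,a),(\xi,r)+\alpha\,\mathrm{d}\widehat{E}(z,a)\bigr)$ is constant for all $(z,a),(\xi,r)$, and $\widehat{\mathbf{F}}$ is the zero-cost flow for $\widehat{\mathcal{L}}$. (b) Suppose $\Psi^*$ is symmetric and $\mathbf{F}$ is pre-GENERIC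 for $S$ with dissipation potentials $(\Psi,\Psi^* )$ and vector field $W$. Then $\widehat{\Psi}^*$ is symmetric and $\widehat{\mathbf{F}}$ is GENERIC for $\widehat{S},\widehat{E}$, with dissipation potentials $(\widehat{\Psi},\widehat{\Psi}^* )$ and map $\widehat{L}$.
   Context: $Z$ is a smooth finite-dimensional manifold; $T_{(z,a)}\widehat Z=T_zZ\times\mathbb{R}$, $T^*_{(z,a)}\widehat Z=T_z^*Z\times\mathbb{R}$; $\langle\cdot,\cdot\rangle$ is the pairing between tangent and cotangent vectors. A vector field is a continuous section of the tangent bundle. $C^1(Z)$: continuously differentiable real functions, differential $\mathrm{d}F(z)\in T_z^*Z$. The following definitions are used on $Z$ and, verbatim, on $\widehat{Z}$. Legendre duals: $f:TZ\to[0,\infty]$ and $g:T^*Z\to(-\infty,\infty]$ with $g(z,\xi)=\sup_v\{\langle v,\xi\rangle-f(z,v)\}$ and $f(z,v)=\sup_\xi\{\langle v,\xi\rangle-g(z,\xi)\}$. Hamiltonians are convex in $\xi$ and vanish at $\xi=0$. Dissipation potentials: a Legendre dual pair $(\Psi,\Psi^* )$ with values in $[0,\infty]$ such that $\Psi,\Psi^*$ are strictly convex (in the second argument) and continuously differentiable, and $\Psi(z,0)=\Psi^*(z,0)=0$. Symmetric: even in the second argument. Reversible: $\mathcal{H}$ is reversible with respect to $S$ if $\mathcal{H}(z,\xi)=\mathcal{H}(z,\mathrm{d}S(z)-\xi)$ for all $(z,\xi)$. Zero-cost flow: $\mathbf{F}$ is the zero-cost flow for $\mathcal{L}$ if $\mathcal{L}(z,v)=0\Leftrightarrow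 v=\mathbf{F}(z)$. Anti-symmetric: $\langle L(z)\xi,\eta\rangle=-\langle L(z)\eta,\xi\rangle$. Jacobi identity: the bracket $\{F,G\}:=\langle\mathrm{d}F,L\,\mathrm{d}G\rangle$ satisfies $\{\{F_1,F_2\},F_3\}+\{\{F_3,F_1\},F_2\}+\{\{F_2,F_3\},F_1\}=0$ for all smooth $F_1,F_2,F_3$. Pre-GENERIC: $\mathbf{F}$ is pre-GENERIC for $S$ with dissipation potentials $(\Psi,\Psi^* )$ and vector field $W$ if $(\Psi,\Psi^* )$ are symmetric dissipation potentials, $\langle W,\mathrm{d}S\rangle=0$ everywhere, and $\Psi(z,\mathbf{F}(z)-W(z))+\Psi^*(z,-\tfrac12\mathrm{d}S(z))+\tfrac12\langle\mathbf{F}(z),\mathrm{d}S(z)\rangle=0$ for all $z$. GENERIC: $\mathbf{F}$ is GENERIC for $S,E$ with dissipation potentials $(\Psi,\Psi^* )$ and map $L$ if $(\Psi,\Psi^* )$ are symmetric dissipation potentials, $L$ is anti-symmetric and satisfies the Jacobi identity, $L(z)\mathrm{d}S(z)=0$ and $\Psi^*(z,\xi+\alpha\,\mathrm{d}E(z))=\Psi^*(z,\xi)$ for all $z,\xi,\alpha$, and $\Psi(z,\mathbf{F}(z)-L(z)\mathrm{d}E(z))+\Psi^*(z,-\tfrac12\mathrm{d}S(z))+\tfrac12\langle\mathbf{F}(z),\mathrm{d}S(z)\rangle=0$ for all $z$.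
   Formalization: In GENERIC, strict convexity of Ψ* is required only off the direction dE, and C¹ of Ψ only on the annihilator of dE (literally Ψ̂* is constant in r, never strictly convex); the Jacobi identity is required where the inner brackets are differentiable, as W is only continuous. *)

theory Defs
  imports "HOL-Analysis.Analysis"
begin

section \<open>Smooth manifolds\<close>

text \<open>
  A function is C^k on an open set of a finite-dimensional space iff all its iterated
  directional derivatives up to order k exist as Frechet derivatives and are continuous.
\<close>

primrec Ck_on :: "nat \<Rightarrow> ('e::real_normed_vector \<Rightarrow> 'f::real_normed_vector) \<Rightarrow> 'e set \<Rightarrow> bool" where
  "Ck_on 0 = (\<lambda>f A. continuous_on A f)"
| "Ck_on (Suc k) = (\<lambda>f A. (\<forall>x\<in>A. f differentiable (at x)) \<and>
     (\<forall>v. Ck_on k (\<lambda>x. frechet_derivative f (at x) v) A))"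

text \<open>A chart is a pair of a domain and a coordinate map; only the values on the domain matter.\<close>

type_synonym ('a, 'e) chart = "'a set \<times> ('a \<Rightarrow> 'e)"

definition chart_inv :: "('a, 'e) chart \<Rightarrow> 'e \<Rightarrow> 'a" where
  "chart_inv c = inv_into (fst c) (snd c)"

definition chart_image :: "('a, 'e) chart \<Rightarrow> 'e set" where
  "chart_image c = snd c ` fst c"

definition is_chart :: "('a::topological_space, 'e::euclidean_space) chart \<Rightarrow> bool" where
  "is_chart c \<longleftrightarrow> open (fst c) \<and> open (chart_image c) \<and>
     homeomorphism (fst c) (chart_image c) (snd c) (chart_inv c)"

text \<open>
  The underlying space is the whole type \<open>'a\<close>, the model space is \<open>'e\<close>. Besides an atlas, the
  structure carries an arbitrary choice of a preferred atlas chart around each point, which is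
  used only to name (co)tangent vectors: \<open>v :: 'e\<close>, read at the point \<open>z\<close>, is the tangent vector
  at \<open>z\<close> whose components in the preferred chart are \<open>v\<close>, and \<open>\<xi> :: 'e\<close>, read at \<open>z\<close>, is the
  covector whose components in the dual basis are \<open>\<xi>\<close>. Thus the pairing is \<open>v \<bullet> \<xi>\<close>.
  No continuity of the preferred chart in \<open>z\<close> is assumed; continuity and differentiability on the
  (co)tangent bundle are always expressed in the bundle charts induced by the atlas.
\<close>

record ('a, 'e) manifold =
  atlas :: "('a, 'e) chart set"
  pref_chart :: "'a \<Rightarrow> ('a, 'e) chart"

definition smooth_manifold ::
    "('a::{t2_space, second_countable_topology}, 'e::euclidean_space) manifold \<Rightarrow> bool" where
  "smooth_manifold M \<longleftrightarrow>
     (\<forall>c\<in>atlas M. is_chart c) \<and>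
     (\<forall>c\<in>atlas M. \<forall>d\<in>atlas M. \<forall>k. Ck_on k (snd d \<circ> chart_inv c) (snd c ` (fst c \<inter> fst d))) \<and>
     (\<forall>z. pref_chart M z \<in> atlas M \<and> z \<in> fst (pref_chart M z))"

definition Ck_fun :: "nat \<Rightarrow> ('a, 'e::euclidean_space) manifold \<Rightarrow> ('a \<Rightarrow> real) \<Rightarrow> bool" where
  "Ck_fun k M f \<longleftrightarrow> (\<forall>c\<in>atlas M. Ck_on k (f \<circ> chart_inv c) (chart_image c))"

definition smooth_fun :: "('a, 'e::euclidean_space) manifold \<Rightarrow> ('a \<Rightarrow> real) \<Rightarrow> bool" where
  "smooth_fun M f \<longleftrightarrow> (\<forall>k. Ck_fun k M f)"

definition differentiable_pt ::
    "('a, 'e::euclidean_space) manifold \<Rightarrow> ('a \<Rightarrow> real) \<Rightarrow> 'a \<Rightarrow> bool" where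
  "differentiable_pt M f z \<longleftrightarrow>
     (f \<circ> chart_inv (pref_chart M z)) differentiable (at (snd (pref_chart M z) z))"

definition differential ::
    "('a, 'e::euclidean_space) manifold \<Rightarrow> ('a \<Rightarrow> real) \<Rightarrow> 'a \<Rightarrow> 'e" where
  "differential M f z =
     (\<Sum>b\<in>Basis. frechet_derivative (f \<circ> chart_inv (pref_chart M z))
        (at (snd (pref_chart M z) z)) b *\<^sub>R b)"

text \<open>
  Change of components of tangent vectors at \<open>z\<close>: \<open>to_chart M c z\<close> maps components in the
  preferred chart to components in \<open>c\<close>, and \<open>from_chart M c z\<close> is its inverse. Components of
  covectors in \<open>c\<close> are mapped to components in the preferred chart by the adjoint of
  \<open>to_chart M c z\<close>.
\<close>

definition to_chart ::
    "('a, 'e::euclidean_space) manifold \<Rightarrow> ('a, 'e) chart \<Rightarrow> 'a \<Rightarrow> 'e \<Rightarrow> 'e" where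
  "to_chart M c z =
     frechet_derivative (snd c \<circ> chart_inv (pref_chart M z)) (at (snd (pref_chart M z) z))"

definition from_chart ::
    "('a, 'e::euclidean_space) manifold \<Rightarrow> ('a, 'e) chart \<Rightarrow> 'a \<Rightarrow> 'e \<Rightarrow> 'e" where
  "from_chart M c z = frechet_derivative (snd (pref_chart M z) \<circ> chart_inv c) (at (snd c z))"

definition vector_field ::
    "('a::topological_space, 'e::euclidean_space) manifold \<Rightarrow> ('a \<Rightarrow> 'e) \<Rightarrow> bool" where
  "vector_field M X \<longleftrightarrow> (\<forall>c\<in>atlas M. continuous_on (fst c) (\<lambda>z. to_chart M c z (X z)))"


section \<open>Legendre duality and dissipation potentials\<close>

definition legendre :: "('a \<Rightarrow> 'e::real_inner \<Rightarrow> ereal) \<Rightarrow> 'a \<Rightarrow> 'e \<Rightarrow> ereal" where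
  "legendre f z \<xi> = (SUP v. ereal (v \<bullet> \<xi>) - f z v)"

definition legendre_dual ::
    "('a \<Rightarrow> 'e::real_inner \<Rightarrow> ereal) \<Rightarrow> ('a \<Rightarrow> 'e \<Rightarrow> ereal) \<Rightarrow> bool" where
  "legendre_dual f g \<longleftrightarrow>
     (\<forall>z v. 0 \<le> f z v) \<and> (\<forall>z \<xi>. g z \<xi> \<noteq> -\<infinity>) \<and> g = legendre f \<and> f = legendre g"

text \<open>
  Continuous differentiability of an extended-real function, within a set \<open>A\<close>: it is demanded
  on the interior of the effective domain relative to \<open>A\<close>. If \<open>A\<close> is open and the function is
  finite on \<open>A\<close>, this says that the function is C^1 on \<open>A\<close>.
\<close>

definition C1_within :: "'b::real_normed_vector set \<Rightarrow> ('b \<Rightarrow> ereal) \<Rightarrow> bool" where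
  "C1_within A f \<longleftrightarrow>
     (let R = {p\<in>A. \<exists>U. open U \<and> p \<in> U \<and> (\<forall>q\<in>U \<inter> A. \<bar>f q\<bar> \<noteq> \<infinity>)} in
      \<exists>D :: 'b \<Rightarrow> 'b \<Rightarrow>\<^sub>L real. continuous_on R D \<and>
        (\<forall>p\<in>R. ((\<lambda>q. real_of_ereal (f q)) has_derivative blinfun_apply (D p)) (at p within A)))"

text \<open>
  Joint continuous differentiability on the tangent bundle, restricted to the vectors annihilated
  by \<open>N\<close>, and on the cotangent bundle, in the bundle charts.
\<close>

definition C1_tangent ::
    "('a, 'e::euclidean_space) manifold \<Rightarrow> ('a \<Rightarrow> 'e set) \<Rightarrow> ('a \<Rightarrow> 'e \<Rightarrow> ereal) \<Rightarrow> bool" where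
  "C1_tangent M N f \<longleftrightarrow> (\<forall>c\<in>atlas M.
     C1_within
       {(x, w). x \<in> chart_image c \<and>
          (\<forall>\<nu>\<in>N (chart_inv c x). from_chart M c (chart_inv c x) w \<bullet> \<nu> = 0)}
       (\<lambda>(x, w). f (chart_inv c x) (from_chart M c (chart_inv c x) w)))"

definition C1_cotangent ::
    "('a, 'e::euclidean_space) manifold \<Rightarrow> ('a \<Rightarrow> 'e \<Rightarrow> ereal) \<Rightarrow> bool" where
  "C1_cotangent M g \<longleftrightarrow> (\<forall>c\<in>atlas M.
     C1_within (chart_image c \<times> UNIV)
       (\<lambda>(x, \<eta>). g (chart_inv c x) (adjoint (to_chart M c (chart_inv c x)) \<eta>)))"

text \<open>
  Strict convexity of an extended-real function along all segments of its effective domain whose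
  direction is not in \<open>N\<close>; for \<open>N = {0}\<close> this is strict convexity.
\<close>

definition strictly_convex_mod :: "'e::real_vector set \<Rightarrow> ('e \<Rightarrow> ereal) \<Rightarrow> bool" where
  "strictly_convex_mod N f \<longleftrightarrow> (\<forall>x y. \<forall>t\<in>{0<..<1}. f x < \<infinity> \<longrightarrow> f y < \<infinity> \<longrightarrow> x - y \<notin> N \<longrightarrow>
     f ((1 - t) *\<^sub>R x + t *\<^sub>R y) < ereal (1 - t) * f x + ereal t * f y)"

text \<open>
  Dissipation potentials that may degenerate along the covectors in \<open>N\<close>. A GENERIC system demands
  that \<open>\<Psi>\<^sup>*\<close> be constant in the direction \<open>dE\<close>, which contradicts strict convexity wherever
  \<open>dE \<noteq> 0\<close>, and dually forces \<open>\<Psi> = \<infinity>\<close> off the annihilator of \<open>dE\<close>. There strict convexity of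
  \<open>\<Psi>\<^sup>*\<close> is therefore read modulo \<open>span {dE}\<close>, and continuous differentiability of \<open>\<Psi>\<close> relative
  to the annihilator of \<open>dE\<close>. For \<open>N = {0}\<close> nothing is relaxed.
\<close>

definition dissipation_potentials_mod ::
    "('a, 'e::euclidean_space) manifold \<Rightarrow> ('a \<Rightarrow> 'e set) \<Rightarrow>
     ('a \<Rightarrow> 'e \<Rightarrow> ereal) \<Rightarrow> ('a \<Rightarrow> 'e \<Rightarrow> ereal) \<Rightarrow> bool" where
  "dissipation_potentials_mod M N \<Psi> \<Psi>s \<longleftrightarrow>
     legendre_dual \<Psi> \<Psi>s \<and> (\<forall>z \<xi>. 0 \<le> \<Psi>s z \<xi>) \<and>
     (\<forall>z. strictly_convex_mod {0} (\<Psi> z)) \<and> (\<forall>z. strictly_convex_mod (N z) (\<Psi>s z)) \<and>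
     C1_tangent M N \<Psi> \<and> C1_cotangent M \<Psi>s \<and>
     (\<forall>z. \<Psi> z 0 = 0) \<and> (\<forall>z. \<Psi>s z 0 = 0)"

definition dissipation_potentials ::
    "('a, 'e::euclidean_space) manifold \<Rightarrow>
     ('a \<Rightarrow> 'e \<Rightarrow> ereal) \<Rightarrow> ('a \<Rightarrow> 'e \<Rightarrow> ereal) \<Rightarrow> bool" where
  "dissipation_potentials M = dissipation_potentials_mod M (\<lambda>_. {0})"

definition symmetric_pot :: "('a \<Rightarrow> 'e::real_vector \<Rightarrow> 'b) \<Rightarrow> bool" where
  "symmetric_pot \<Phi> \<longleftrightarrow> (\<forall>z x. \<Phi> z (- x) = \<Phi> z x)"

definition potential_relation ::
    "('a, 'e::euclidean_space) manifold \<Rightarrow> ('a \<Rightarrow> real) \<Rightarrow>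
     ('a \<Rightarrow> 'e \<Rightarrow> real) \<Rightarrow> ('a \<Rightarrow> 'e \<Rightarrow> real) \<Rightarrow> bool" where
  "potential_relation M S \<Psi>s H \<longleftrightarrow>
     (\<forall>z \<xi>. \<Psi>s z \<xi> = H z (\<xi> + (1/2) *\<^sub>R differential M S z) - H z ((1/2) *\<^sub>R differential M S z)) \<and>
     (\<forall>z \<xi>. H z \<xi> = \<Psi>s z (\<xi> - (1/2) *\<^sub>R differential M S z) - \<Psi>s z (- (1/2) *\<^sub>R differential M S z))"

definition reversible ::
    "('a, 'e::euclidean_space) manifold \<Rightarrow> ('a \<Rightarrow> 'e \<Rightarrow> real) \<Rightarrow> ('a \<Rightarrow> real) \<Rightarrow> bool" where
  "reversible M H S \<longleftrightarrow> Ck_fun 1 M S \<and> (\<forall>z \<xi>. H z \<xi> = H z (differential M S z - \<xi>))"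

definition zero_cost_flow ::
    "('a::topological_space, 'e::euclidean_space) manifold \<Rightarrow>
     ('a \<Rightarrow> 'e) \<Rightarrow> ('a \<Rightarrow> 'e \<Rightarrow> ereal) \<Rightarrow> bool" where
  "zero_cost_flow M F Lag \<longleftrightarrow> vector_field M F \<and> (\<forall>z v. Lag z v = 0 \<longleftrightarrow> v = F z)"


section \<open>Pre-GENERIC and GENERIC\<close>

definition antisymmetric :: "('a \<Rightarrow> 'e::real_inner \<Rightarrow> 'e) \<Rightarrow> bool" where
  "antisymmetric L \<longleftrightarrow> (\<forall>z \<xi> \<eta>. L z \<xi> \<bullet> \<eta> = - (L z \<eta> \<bullet> \<xi>))"

definition bracket ::
    "('a, 'e::euclidean_space) manifold \<Rightarrow> ('a \<Rightarrow> 'e \<Rightarrow> 'e) \<Rightarrow>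
     ('a \<Rightarrow> real) \<Rightarrow> ('a \<Rightarrow> real) \<Rightarrow> 'a \<Rightarrow> real" where
  "bracket M L F G z = L z (differential M G z) \<bullet> differential M F z"

text \<open>
  If \<open>L\<close> is merely continuous, the bracket of smooth functions need not be differentiable; the
  identity is demanded at all points at which the nested brackets are defined. If \<open>L\<close> is C^1,
  these are all points.
\<close>

definition jacobi_identity ::
    "('a, 'e::euclidean_space) manifold \<Rightarrow> ('a \<Rightarrow> 'e \<Rightarrow> 'e) \<Rightarrow> bool" where
  "jacobi_identity M L \<longleftrightarrow>
     (\<forall>F1 F2 F3. smooth_fun M F1 \<longrightarrow> smooth_fun M F2 \<longrightarrow> smooth_fun M F3 \<longrightarrow>
       (\<forall>z. differentiable_pt M (bracket M L F1 F2) z \<longrightarrow>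
            differentiable_pt M (bracket M L F3 F1) z \<longrightarrow>
            differentiable_pt M (bracket M L F2 F3) z \<longrightarrow>
            bracket M L (bracket M L F1 F2) F3 z +
            bracket M L (bracket M L F3 F1) F2 z +
            bracket M L (bracket M L F2 F3) F1 z = 0))"

definition pre_generic ::
    "('a::topological_space, 'e::euclidean_space) manifold \<Rightarrow> ('a \<Rightarrow> 'e) \<Rightarrow> ('a \<Rightarrow> real) \<Rightarrow>
     ('a \<Rightarrow> 'e \<Rightarrow> ereal) \<Rightarrow> ('a \<Rightarrow> 'e \<Rightarrow> ereal) \<Rightarrow> ('a \<Rightarrow> 'e) \<Rightarrow> bool" where
  "pre_generic M F S \<Psi> \<Psi>s W \<longleftrightarrow>
     vector_field M F \<and> vector_field M W \<and> Ck_fun 1 M S \<and>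
     dissipation_potentials M \<Psi> \<Psi>s \<and> symmetric_pot \<Psi> \<and> symmetric_pot \<Psi>s \<and>
     (\<forall>z. W z \<bullet> differential M S z = 0) \<and>
     (\<forall>z. \<Psi> z (F z - W z) + \<Psi>s z (- (1/2) *\<^sub>R differential M S z)
            + ereal (1/2 * (F z \<bullet> differential M S z)) = 0)"

definition generic ::
    "('a::topological_space, 'e::euclidean_space) manifold \<Rightarrow> ('a \<Rightarrow> 'e) \<Rightarrow>
     ('a \<Rightarrow> real) \<Rightarrow> ('a \<Rightarrow> real) \<Rightarrow>
     ('a \<Rightarrow> 'e \<Rightarrow> ereal) \<Rightarrow> ('a \<Rightarrow> 'e \<Rightarrow> ereal) \<Rightarrow> ('a \<Rightarrow> 'e \<Rightarrow> 'e) \<Rightarrow> bool" where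
  "generic M F S E \<Psi> \<Psi>s L \<longleftrightarrow>
     vector_field M F \<and> Ck_fun 1 M S \<and> Ck_fun 1 M E \<and>
     dissipation_potentials_mod M (\<lambda>z. span {differential M E z}) \<Psi> \<Psi>s \<and>
     symmetric_pot \<Psi> \<and> symmetric_pot \<Psi>s \<and>
     antisymmetric L \<and> jacobi_identity M L \<and>
     (\<forall>z. L z (differential M S z) = 0) \<and>
     (\<forall>z \<xi> \<alpha>. \<Psi>s z (\<xi> + \<alpha> *\<^sub>R differential M E z) = \<Psi>s z \<xi>) \<and>
     (\<forall>z. \<Psi> z (F z - L z (differential M E z)) + \<Psi>s z (- (1/2) *\<^sub>R differential M S z)
            + ereal (1/2 * (F z \<bullet> differential M S z)) = 0)"


section \<open>The extended system on the product with the real line\<close>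

definition chart_times_line ::
    "('a, 'e) chart \<Rightarrow> ('a \<times> real, 'e \<times> real) chart" where
  "chart_times_line c = (fst c \<times> UNIV, \<lambda>(z, a). (snd c z, a))"

definition times_line :: "('a, 'e) manifold \<Rightarrow> ('a \<times> real, 'e \<times> real) manifold" where
  "times_line M =
     \<lparr>atlas = chart_times_line ` atlas M, pref_chart = (\<lambda>(z, a). chart_times_line (pref_chart M z))\<rparr>"

definition F_hat :: "('a \<Rightarrow> 'e) \<Rightarrow> 'a \<times> real \<Rightarrow> 'e \<times> real" where
  "F_hat F = (\<lambda>(z, a). (F z, 0))"

definition S_hat :: "('a \<Rightarrow> real) \<Rightarrow> 'a \<times> real \<Rightarrow> real" where
  "S_hat S = (\<lambda>(z, a). S z)"

definition E_hat :: "'a \<times> real \<Rightarrow> real" where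
  "E_hat = (\<lambda>(z, a). a)"

text \<open>Serves for the potential \<open>\<Psi>\<^sup>*\<close> as well as for the Hamiltonians.\<close>

definition cotangent_hat :: "('a \<Rightarrow> 'e \<Rightarrow> 'b) \<Rightarrow> 'a \<times> real \<Rightarrow> 'e \<times> real \<Rightarrow> 'b" where
  "cotangent_hat H = (\<lambda>(z, a) (\<xi>, r). H z \<xi>)"

definition L_hat :: "('a \<Rightarrow> 'e::real_inner) \<Rightarrow> 'a \<times> real \<Rightarrow> 'e \<times> real \<Rightarrow> 'e \<times> real" where
  "L_hat W = (\<lambda>(z, a) (\<xi>, r). (r *\<^sub>R W z, - (W z \<bullet> \<xi>)))"


section \<open>The product with the real line is a smooth manifold\<close>

lemma Ck_on_cong:
  assumes "open A" "\<And>x. x \<in> A \<Longrightarrow> f x = g x" "Ck_on k f A"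
  shows "Ck_on k g A"
  using assms
proof (induction k arbitrary: f g)
  case 0
  then show ?case by (simp cong: continuous_on_cong)
next
  case (Suc k)
  have d: "(g has_derivative frechet_derivative f (at x)) (at x)" if "x \<in> A" for x
  proof (rule has_derivative_transform_within_open[OF _ Suc.prems(1) that])
    show "(f has_derivative frechet_derivative f (at x)) (at x)"
      using Suc.prems(3) that by (simp add: frechet_derivative_works)
  qed (use Suc.prems(2) in auto)
  then have e: "frechet_derivative g (at x) = frechet_derivative f (at x)" if "x \<in> A" for x
    using frechet_derivative_at[OF d[OF that]] by simp
  show ?case
  proof (simp, intro conjI allI ballI)
    show "g differentiable at x" if "x \<in> A" for x
      using d[OF that] by (auto simp: differentiable_def)
    show "Ck_on k (\<lambda>x. frechet_derivative g (at x) v) A" for v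
      by (rule Suc.IH[of "\<lambda>x. frechet_derivative f (at x) v"]) (use Suc.prems(1,3) in \<open>auto simp: e\<close>)
  qed
qed

lemma Ck_on_times_line:
  fixes f :: "'e::real_normed_vector \<Rightarrow> 'f::real_normed_vector"
  assumes "open A" "Ck_on k f A"
  shows "Ck_on k (\<lambda>(x, a::real). (f x, u * a + w :: real)) (A \<times> UNIV)"
  using assms
proof (induction k arbitrary: f u w)
  case 0
  then show ?case
    by (auto simp: case_prod_unfold intro!: continuous_intros continuous_on_compose2[of A f])
next
  case (Suc k)
  let ?h = "\<lambda>(x, a::real). (f x, u * a + w :: real)"
  let ?D = "\<lambda>p q. (frechet_derivative f (at (fst p)) (fst q), u * snd q)"
  have d: "(?h has_derivative ?D p) (at p)" if "p \<in> A \<times> UNIV" for p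
  proof -
    have "(f has_derivative frechet_derivative f (at (fst p))) (at (fst p))"
      using Suc.prems(2) that by (auto simp: frechet_derivative_works)
    from has_derivative_compose[OF has_derivative_fst[OF has_derivative_ident] this]
    show ?thesis unfolding case_prod_unfold
      by (auto intro!: derivative_eq_intros)
  qed
  have e: "frechet_derivative ?h (at p) = ?D p" if "p \<in> A \<times> UNIV" for p
    using frechet_derivative_at[OF d[OF that]] by simp
  have o: "open (A \<times> (UNIV::real set))" using Suc.prems(1) by (simp add: open_Times)
  show ?case
  proof (simp only: Ck_on.simps, intro conjI allI ballI)
    show "?h differentiable at p" if "p \<in> A \<times> UNIV" for p
      using d[OF that] by (auto simp: differentiable_def)
    fix v :: "'e \<times> real"
    have "Ck_on k (\<lambda>(x, a::real). (frechet_derivative f (at x) (fst v), 0 * a + u * snd v)) (A \<times> UNIV)"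
      by (rule Suc.IH) (use Suc.prems in auto)
    then show "Ck_on k (\<lambda>p. frechet_derivative ?h (at p) v) (A \<times> UNIV)"
      by (rule Ck_on_cong[OF o, rotated]) (subst e, auto)
  qed
qed

lemma is_chart_image:
  assumes "is_chart c" "U \<subseteq> fst c" "open U" shows "open (snd c ` U)"
proof -
  have h: "homeomorphism (chart_image c) (fst c) (chart_inv c) (snd c)" "open (chart_image c)"
    using assms(1) by (auto simp: is_chart_def intro: homeomorphism_symD)
  then have "continuous_on (chart_image c) (chart_inv c)" by (simp add: homeomorphism_def)
  moreover have "snd c ` U = chart_image c \<inter> chart_inv c -` U"
  proof (rule set_eqI)
    fix y show "y \<in> snd c ` U \<longleftrightarrow> y \<in> chart_image c \<inter> chart_inv c -` U"
    proof
      assume "y \<in> snd c ` U"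
      then obtain x where x: "x \<in> U" "y = snd c x" by auto
      with h(1) assms(2) have "chart_inv c y = x" unfolding homeomorphism_def by auto
      then show "y \<in> chart_image c \<inter> chart_inv c -` U" using x assms(2) by (auto simp: chart_image_def)
    next
      assume y: "y \<in> chart_image c \<inter> chart_inv c -` U"
      then have "snd c (chart_inv c y) = y" using h(1) unfolding homeomorphism_def by auto
      then show "y \<in> snd c ` U" using y by (intro image_eqI[of _ _ "chart_inv c y"]) auto
    qed
  qed
  ultimately show ?thesis using continuous_open_preimage[OF _ h(2) assms(3)] by simp
qed

lemma chart_times_line_simps [simp]:
  "fst (chart_times_line c) = fst c \<times> UNIV"
  "snd (chart_times_line c) = (\<lambda>(z, a). (snd c z, a))"
  "chart_image (chart_times_line c) = chart_image c \<times> UNIV"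
  by (auto simp: chart_times_line_def chart_image_def image_iff)

lemma chart_inv_times_line:
  assumes "is_chart c" "x \<in> chart_image c"
  shows "chart_inv (chart_times_line c) (x, a) = (chart_inv c x, a)"
proof -
  have inj: "inj_on (snd c) (fst c)"
    using assms(1) unfolding is_chart_def homeomorphism_def by (metis inj_on_inverseI)
  obtain z where z: "z \<in> fst c" "x = snd c z" using assms(2) by (auto simp: chart_image_def)
  have "inj_on (snd (chart_times_line c)) (fst (chart_times_line c))"
    using inj by (auto simp: inj_on_def)
  from inv_into_f_f[OF this, of "(z, a)"] inv_into_f_f[OF inj z(1)] z
  show ?thesis by (simp add: chart_inv_def)
qed

lemma is_chart_times_line:
  assumes c: "is_chart c" shows "is_chart (chart_times_line c)"
proof -
  have h: "open (fst c)" "open (chart_image c)" "homeomorphism (fst c) (chart_image c) (snd c) (chart_inv c)"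
    using c by (auto simp: is_chart_def)
  have "homeomorphism (fst c \<times> (UNIV::real set)) (chart_image c \<times> UNIV)
          (\<lambda>(z, a). (snd c z, a)) (\<lambda>(x, a). (chart_inv c x, a))"
  proof (rule homeomorphismI)
    have "continuous_on (fst c) (snd c)" "continuous_on (chart_image c) (chart_inv c)"
      using h(3) by (auto simp: homeomorphism_def)
    then show "continuous_on (fst c \<times> (UNIV::real set)) (\<lambda>(z, a). (snd c z, a))"
      and "continuous_on (chart_image c \<times> (UNIV::real set)) (\<lambda>(x, a). (chart_inv c x, a))"
      unfolding case_prod_unfold
      by (auto intro!: continuous_on_Pair continuous_on_fst continuous_on_snd continuous_on_id
          elim: continuous_on_compose2[OF _ continuous_on_fst[OF continuous_on_id]])
  qed (use h(3) in \<open>auto simp: homeomorphism_def\<close>)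
  then have "homeomorphism (fst c \<times> (UNIV::real set)) (chart_image c \<times> UNIV)
          (\<lambda>(z, a). (snd c z, a)) (chart_inv (chart_times_line c))"
    by (rule homeomorphism_cong) (auto simp: chart_inv_times_line[OF c])
  then show ?thesis using h by (simp add: is_chart_def open_Times)
qed

lemma smooth_manifold_times_line:
  assumes M: "smooth_manifold M" shows "smooth_manifold (times_line M)"
proof -
  have ch: "is_chart c" if "c \<in> atlas M" for c using M that by (simp add: smooth_manifold_def)
  have "Ck_on k (snd (chart_times_line d) \<circ> chart_inv (chart_times_line c))
          (snd (chart_times_line c) ` (fst (chart_times_line c) \<inter> fst (chart_times_line d)))"
    if cd: "c \<in> atlas M" "d \<in> atlas M" for c d k
  proof -
    let ?A = "snd c ` (fst c \<inter> fst d)"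
    have A: "open ?A" using ch[OF cd(1)] ch[OF cd(2)]
      by (intro is_chart_image) (auto simp: is_chart_def)
    have s: "snd (chart_times_line c) ` (fst (chart_times_line c) \<inter> fst (chart_times_line d)) = ?A \<times> UNIV"
      by (auto simp: image_iff)
    have "Ck_on k (snd d \<circ> chart_inv c) ?A" using M cd by (simp add: smooth_manifold_def)
    from Ck_on_times_line[OF A this, of 1 0]
    show ?thesis unfolding s
      by (rule Ck_on_cong[rotated 2])
         (use A in \<open>auto simp: open_Times chart_image_def chart_inv_times_line[OF ch[OF cd(1)]]\<close>)
  qed
  then show ?thesis using M
    by (auto simp: smooth_manifold_def times_line_def is_chart_times_line)
qed

lemma to_chart_pref:
  assumes M: "smooth_manifold M" shows "to_chart M (pref_chart M z) z = id"
proof -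
  let ?c = "pref_chart M z"
  have c: "is_chart ?c" "z \<in> fst ?c" using M by (auto simp: smooth_manifold_def)
  have "((snd ?c \<circ> chart_inv ?c) has_derivative id) (at (snd ?c z))"
    by (rule has_derivative_transform_within_open[where f=id and s="chart_image ?c"])
       (use c in \<open>auto simp: is_chart_def homeomorphism_def chart_image_def id_def\<close>)
  then show ?thesis unfolding to_chart_def by (metis frechet_derivative_at)
qed

end

theory Submission
  imports Defs
begin

text \<open>
  The Legendre dual of a function on \<open>T\<^sup>*Z\<close>, extended so as not to depend on the additional
  covector component \<open>r\<close>, is the old dual where the additional velocity component \<open>s\<close> vanishes
  and \<open>\<infinity>\<close> elsewhere. With this, everything but the Jacobi identity is a computation.

  The bracket of \<open>L_hat W\<close> is \<open>{F, G} = F\<^sub>W G\<^sub>a - F\<^sub>a G\<^sub>W\<close>, where \<open>F\<^sub>W\<close> and \<open>F\<^sub>a\<close> are derivatives along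
  \<open>W\<close> and along the line. If \<open>W\<close> were \<open>C\<^sup>1\<close>, the Jacobi identity would hold because \<open>W\<close> and
  \<open>\<partial>\<^sub>a\<close> commute. For a merely continuous \<open>W\<close>, split \<open>{F, G}\<close> near a point \<open>p\<close> in a chart into a
  part in which only \<open>W\<close> varies and a part in which \<open>W\<close> is frozen at \<open>p\<close>, up to a remainder with
  zero derivative at \<open>p\<close>. The frozen part satisfies the Jacobi identity, since partial
  derivatives commute. The varying part is independent of \<open>a\<close>, and its contributions cancel
  in the cyclic sum, because the combination with the weights \<open>H\<^sub>a\<close>, \<open>G\<^sub>a\<close>, \<open>F\<^sub>a\<close> at \<open>p\<close> vanishes
  identically before differentiation.
\<close>

section \<open>The Jacobi identity in a chart\<close>

lemma second_difference_mvt: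
  fixes f :: "'e::real_normed_vector \<Rightarrow> real"
  assumes "0 < h"
    and A: "\<And>s t. s \<in> {0..h} \<Longrightarrow> t \<in> {0..h} \<Longrightarrow> x + s *\<^sub>R u + t *\<^sub>R v \<in> A"
    and f: "\<And>y. y \<in> A \<Longrightarrow> f differentiable (at y)"
    and fu: "\<And>y. y \<in> A \<Longrightarrow> (\<lambda>y. frechet_derivative f (at y) u) differentiable (at y)"
  shows "\<exists>s\<in>{0<..<h}. \<exists>t\<in>{0<..<h}.
    f (x + h *\<^sub>R u + h *\<^sub>R v) - f (x + h *\<^sub>R u) - f (x + h *\<^sub>R v) + f x =
    h * h * frechet_derivative (\<lambda>y. frechet_derivative f (at y) u) (at (x + s *\<^sub>R u + t *\<^sub>R v)) v"
proof -
  define fu' where "fu' = (\<lambda>y. frechet_derivative f (at y) u)"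
  have d1: "((\<lambda>s. f (x + s *\<^sub>R u + t *\<^sub>R v)) has_derivative
      (\<lambda>d. d * fu' (x + s *\<^sub>R u + t *\<^sub>R v))) (at s within X)"
    if "s \<in> {0..h}" "t \<in> {0..h}" for s t X
  proof -
    have "(f has_derivative frechet_derivative f (at (x + s *\<^sub>R u + t *\<^sub>R v))) (at (x + s *\<^sub>R u + t *\<^sub>R v))"
      using f[OF A[OF that]] by (simp add: frechet_derivative_works)
    then have "((\<lambda>s. f (x + s *\<^sub>R u + t *\<^sub>R v)) has_derivative
      (\<lambda>d. frechet_derivative f (at (x + s *\<^sub>R u + t *\<^sub>R v)) (d *\<^sub>R u))) (at s within X)"
      by (rule has_derivative_compose[rotated]) (auto intro!: derivative_eq_intros)
    moreover have "linear (frechet_derivative f (at (x + s *\<^sub>R u + t *\<^sub>R v)))"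
      using f[OF A[OF that]] by (rule linear_frechet_derivative)
    ultimately show ?thesis by (simp add: fu'_def linear_cmul)
  qed
  have d2: "((\<lambda>t. fu' (x + s *\<^sub>R u + t *\<^sub>R v)) has_derivative
      (\<lambda>d. d * frechet_derivative fu' (at (x + s *\<^sub>R u + t *\<^sub>R v)) v)) (at t within X)"
    if "s \<in> {0..h}" "t \<in> {0..h}" for s t X
  proof -
    have df: "fu' differentiable (at (x + s *\<^sub>R u + t *\<^sub>R v))"
      using fu[OF A[OF that]] by (simp add: fu'_def)
    then have "((\<lambda>t. fu' (x + s *\<^sub>R u + t *\<^sub>R v)) has_derivative
      (\<lambda>d. frechet_derivative fu' (at (x + s *\<^sub>R u + t *\<^sub>R v)) (d *\<^sub>R v))) (at t within X)"
      unfolding frechet_derivative_works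
      by (rule has_derivative_compose[rotated]) (auto intro!: derivative_eq_intros)
    then show ?thesis using linear_frechet_derivative[OF df] by (simp add: linear_cmul)
  qed
  \<comment> \<open>The second difference is the increment over \<open>[0, h]\<close> of the
    difference in direction \<open>v\<close>. The mean value theorem along \<open>u\<close> turns it
    into a difference of \<open>u\<close>-derivatives, and a second application along
    \<open>v\<close> yields the mixed derivative.\<close>
  let ?\<phi> = "\<lambda>s. f (x + s *\<^sub>R u + h *\<^sub>R v) - f (x + s *\<^sub>R u + 0 *\<^sub>R v)"
  have "\<exists>s\<in>{0<..<h}. ?\<phi> h - ?\<phi> 0 =
      (h - 0) * fu' (x + s *\<^sub>R u + h *\<^sub>R v) - (h - 0) * fu' (x + s *\<^sub>R u + 0 *\<^sub>R v)"
    using assms(1) by (intro mvt_simple has_derivative_diff d1) auto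
  then obtain s where s: "s \<in> {0<..<h}"
    "?\<phi> h - ?\<phi> 0 = h * (fu' (x + s *\<^sub>R u + h *\<^sub>R v) - fu' (x + s *\<^sub>R u + 0 *\<^sub>R v))"
    by (auto simp: right_diff_distrib)
  have "\<exists>t\<in>{0<..<h}. fu' (x + s *\<^sub>R u + h *\<^sub>R v) - fu' (x + s *\<^sub>R u + 0 *\<^sub>R v) =
      (h - 0) * frechet_derivative fu' (at (x + s *\<^sub>R u + t *\<^sub>R v)) v"
    using assms(1) s(1) by (intro mvt_simple d2) auto
  then obtain t where "t \<in> {0<..<h}"
    "fu' (x + s *\<^sub>R u + h *\<^sub>R v) - fu' (x + s *\<^sub>R u + 0 *\<^sub>R v) =
      h * frechet_derivative fu' (at (x + s *\<^sub>R u + t *\<^sub>R v)) v" by auto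
  with s show ?thesis
    unfolding fu'_def by (intro bexI[of _ s] bexI[of _ t]) (auto simp: algebra_simps)
qed

text \<open>The second difference over a small parallelogram is symmetric in \<open>u\<close> and
  \<open>v\<close>, and it equals \<open>h * h\<close> times either mixed derivative at some nearby
  point. Continuity of both at \<open>x\<close> then leaves no gap between their values.\<close>

lemma Ck_on_2_mixed_derivatives:
  fixes f :: "'e::real_normed_vector \<Rightarrow> real"
  assumes "open A" "x \<in> A" and f: "Ck_on 2 f A"
  shows "frechet_derivative (\<lambda>y. frechet_derivative f (at y) u) (at x) v =
         frechet_derivative (\<lambda>y. frechet_derivative f (at y) v) (at x) u"
proof (rule ccontr)
  let ?D = "\<lambda>u v y. frechet_derivative (\<lambda>y. frechet_derivative f (at y) u) (at y) v"
  assume ne: "?D u v x \<noteq> ?D v u x"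
  \<comment> \<open>Half the gap: two numbers strictly within this distance of the two different
    values cannot coincide.\<close>
  define \<epsilon> where "\<epsilon> = \<bar>?D u v x - ?D v u x\<bar> / 2"
  have "\<epsilon> > 0" using ne by (simp add: \<epsilon>_def)
  have f2: "Ck_on (Suc (Suc 0)) f A" using f by (simp add: numeral_2_eq_2)
  have near: "\<forall>\<^sub>F y in nhds x. dist (?D u v y) (?D u v x) < \<epsilon>" for u v
  proof -
    have "continuous_on A (?D u v)" using f2 by simp
    then have "isCont (?D u v) x" using assms by (simp add: continuous_on_eq_continuous_at)
    then show ?thesis
      using \<open>\<epsilon> > 0\<close> by (intro tendstoD) (simp_all add: isCont_def tendsto_at_iff_tendsto_nhds[of "?D u v"])
  qed
  have "\<forall>\<^sub>F y in nhds x. y \<in> A \<and> dist (?D u v y) (?D u v x) < \<epsilon> \<and> dist (?D v u y) (?D v u x) < \<epsilon>"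
    using near eventually_nhds_in_open[OF assms(1,2)] by (intro eventually_conj) auto
  then obtain \<delta> where \<delta>: "\<delta> > 0" "\<And>y. dist y x < \<delta> \<Longrightarrow>
      y \<in> A \<and> dist (?D u v y) (?D u v x) < \<epsilon> \<and> dist (?D v u y) (?D v u x) < \<epsilon>"
    unfolding eventually_nhds_metric by blast
  \<comment> \<open>The whole parallelogram with sides \<open>h *\<^sub>R u\<close> and
    \<open>h *\<^sub>R v\<close> stays in the \<open>\<delta>\<close>-ball. The added 1 keeps the
    denominator positive for \<open>u = v = 0\<close> and makes the bound strict.\<close>
  define h where "h = \<delta> / (norm u + norm v + 1)"
  have h: "h > 0" "h * (norm u + norm v) < \<delta>"
  proof -
    have pos: "norm u + norm v + 1 > 0" by (intro add_nonneg_pos) auto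
    then show "h > 0" using \<delta>(1) by (simp add: h_def)
    moreover have "h * (norm u + norm v + 1) = \<delta>" using pos by (simp add: h_def)
    ultimately show "h * (norm u + norm v) < \<delta>" by (simp add: distrib_left)
  qed
  have close: "dist (x + s *\<^sub>R u + t *\<^sub>R v) x < \<delta>" if "s \<in> {0..h}" "t \<in> {0..h}" for s t
  proof -
    have "dist (x + s *\<^sub>R u + t *\<^sub>R v) x \<le> s * norm u + t * norm v"
      using that norm_triangle_ineq[of "s *\<^sub>R u" "t *\<^sub>R v"] by (simp add: dist_norm add.assoc)
    also have "\<dots> \<le> h * norm u + h * norm v"
      using that by (intro add_mono mult_right_mono) auto
    finally show ?thesis using h(2) by (simp add: distrib_left)
  qed
  obtain s t where st: "s \<in> {0<..<h}" "t \<in> {0<..<h}"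
    "f (x + h *\<^sub>R u + h *\<^sub>R v) - f (x + h *\<^sub>R u) - f (x + h *\<^sub>R v) + f x = h * h * ?D u v (x + s *\<^sub>R u + t *\<^sub>R v)"
    using second_difference_mvt[of h x u v A f] h(1) close \<delta>(2) f2 by (auto simp del: Ck_on.simps(1))
  have close': "dist (x + s *\<^sub>R v + t *\<^sub>R u) x < \<delta>" if "s \<in> {0..h}" "t \<in> {0..h}" for s t
    using close[OF that(2,1)] by (simp add: algebra_simps)
  obtain s' t' where st': "s' \<in> {0<..<h}" "t' \<in> {0<..<h}"
    "f (x + h *\<^sub>R v + h *\<^sub>R u) - f (x + h *\<^sub>R v) - f (x + h *\<^sub>R u) + f x = h * h * ?D v u (x + s' *\<^sub>R v + t' *\<^sub>R u)"
    using second_difference_mvt[of h x v u A f] h(1) close' \<delta>(2) f2 by (auto simp del: Ck_on.simps(1))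
  have "?D u v (x + s *\<^sub>R u + t *\<^sub>R v) = ?D v u (x + s' *\<^sub>R v + t' *\<^sub>R u)"
    using st(3) st'(3) h(1) by (simp add: algebra_simps)
  moreover have "dist (?D u v (x + s *\<^sub>R u + t *\<^sub>R v)) (?D u v x) < \<epsilon>"
    "dist (?D v u (x + s' *\<^sub>R v + t' *\<^sub>R u)) (?D v u x) < \<epsilon>"
    using \<delta>(2)[OF close[of s t]] \<delta>(2)[OF close'[of s' t']] st(1,2) st'(1,2) by auto
  ultimately show False unfolding \<epsilon>_def dist_real_def by argo
qed

text \<open>Near \<open>p\<close>, \<open>k\<close> is of order \<open>norm (q - p)\<close> while
  \<open>u\<close> tends to 0, so the product is of smaller order. This absorbs the error of
  freezing a merely continuous field.\<close>

lemma has_derivative_mult_continuous_zero: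
  fixes u k :: "'e::real_normed_vector \<Rightarrow> real"
  assumes u: "isCont u p" "u p = 0" and k: "(k has_derivative k') (at p)" "k p = 0"
  shows "((\<lambda>q. u q * k q) has_derivative (\<lambda>_. 0)) (at p)"
proof -
  obtain B where B: "\<And>x. norm (k' x) \<le> norm x * B" "B > 0"
    using has_derivative_bounded_linear[OF k(1)] bounded_linear.pos_bounded by blast
  have 1: "(\<lambda>y. (k y - k' (y - p)) / norm (y - p)) \<midarrow>p\<rightarrow> 0"
    using k by (simp add: has_derivative_within divide_inverse mult.commute)
  have 2: "u \<midarrow>p\<rightarrow> 0" using u by (simp add: isCont_def)
  \<comment> \<open>At \<open>y = p\<close> the quotient is 0 by the convention for division by
    zero, so the bound holds for all \<open>y\<close>.\<close>
  have b: "norm (k' (y - p) / norm (y - p)) \<le> B" for y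
    using B(1)[of "y - p"] B(2) by (cases "y = p") (auto simp: field_simps)
  have 3: "(\<lambda>y. u y * (k' (y - p) / norm (y - p))) \<midarrow>p\<rightarrow> 0"
  proof (rule Lim_null_comparison)
    show "\<forall>\<^sub>F y in at p. norm (u y * (k' (y - p) / norm (y - p))) \<le> norm (u y) * B"
      unfolding norm_mult using b by (intro always_eventually allI mult_left_mono) auto
    show "(\<lambda>y. norm (u y) * B) \<midarrow>p\<rightarrow> 0" using 2 by (auto intro!: tendsto_eq_intros)
  qed
  \<comment> \<open>The first summand is \<open>u\<close> times the remainder quotient of
    \<open>k\<close>, the second is \<open>u\<close> times a bounded quotient. In their sum the
    terms in \<open>k'\<close> cancel.\<close>
  have "(\<lambda>y. u y * ((k y - k' (y - p)) / norm (y - p)) + u y * (k' (y - p) / norm (y - p))) \<midarrow>p\<rightarrow> 0"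
    using tendsto_add[OF tendsto_mult[OF 2 1] 3] by simp
  then have "(\<lambda>y. u y * k y / norm (y - p)) \<midarrow>p\<rightarrow> 0"
    by (simp add: field_simps add_divide_distrib diff_divide_distrib)
  then show ?thesis using u k
    by (simp add: has_derivative_within divide_inverse mult.commute)
qed

lemma has_derivative_zero_along_line:
  fixes f :: "'e::real_normed_vector \<Rightarrow> real"
  assumes "(f has_derivative f') (at p)" "\<And>t. f (p + t *\<^sub>R e) = f p"
  shows "f' e = 0"
proof -
  have "(f has_derivative f') (at (p + 0 *\<^sub>R e))" using assms(1) by simp
  then have "((\<lambda>t. f (p + t *\<^sub>R e)) has_derivative (\<lambda>d. f' (d *\<^sub>R e))) (at 0)"
    by (rule has_derivative_compose[rotated]) (auto intro!: derivative_eq_intros)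
  then have "((\<lambda>t::real. f p) has_derivative (\<lambda>d. f' (d *\<^sub>R e))) (at 0)"
    by (simp add: assms(2))
  from has_derivative_unique[OF this has_derivative_const] show ?thesis
    by (metis scaleR_one)
qed


text \<open>The bracket of \<open>L_hat W\<close> in a chart, in which \<open>V\<close> represents \<open>W\<close>.\<close>

definition partial_bracket ::
    "('e::real_normed_vector \<Rightarrow> 'e) \<Rightarrow> ('e \<times> real \<Rightarrow> real) \<Rightarrow> ('e \<times> real \<Rightarrow> real) \<Rightarrow> 'e \<times> real \<Rightarrow> real" where
  "partial_bracket V f g q =
     frechet_derivative f (at q) (V (fst q), 0) * frechet_derivative g (at q) (0, 1) -
     frechet_derivative f (at q) (0, 1) * frechet_derivative g (at q) (V (fst q), 0)"

text \<open>
  \<open>\<Phi>\<close> freezes everything but \<open>V\<close> at \<open>p\<close>, and \<open>C\<close> freezes only \<open>V\<close>. Their derivatives at \<open>p\<close> add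
  up to that of the bracket, so differentiability of the bracket passes to \<open>\<Phi>\<close> although \<open>V\<close> is
  only continuous.
\<close>

lemma partial_bracket_derivative:
  fixes V :: "'e::euclidean_space \<Rightarrow> 'e" and f g :: "'e \<times> real \<Rightarrow> real" and p :: "'e \<times> real"
  defines "\<Phi> \<equiv> \<lambda>q. frechet_derivative f (at p) (V (fst q), 0) * frechet_derivative g (at p) (0, 1) -
     frechet_derivative f (at p) (0, 1) * frechet_derivative g (at p) (V (fst q), 0)"
    and "C \<equiv> partial_bracket (\<lambda>_. V (fst p)) f g"
  assumes A: "open A" "p \<in> A" and f: "Ck_on 2 f A" and g: "Ck_on 2 g A"
    and V: "isCont V (fst p)"
    and diff: "partial_bracket V f g differentiable (at p)"
  obtains \<Phi>' C' where "(\<Phi> has_derivative \<Phi>') (at p)" "(C has_derivative C') (at p)"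
    "frechet_derivative (partial_bracket V f g) (at p) = (\<lambda>d. \<Phi>' d + C' d)"
    "\<Phi>' (0, 1) = 0"
proof -
  \<comment> \<open>\<open>B q v\<close> is the bracket with the vector \<open>v\<close> in place of
    \<open>V (fst q)\<close>. This separates the dependence on \<open>q\<close> through the field,
    linear in \<open>v\<close>, from the one through the derivatives of \<open>f\<close> and
    \<open>g\<close>.\<close>
  define B where "B = (\<lambda>q v. frechet_derivative f (at q) (v, 0) * frechet_derivative g (at q) (0, 1) -
     frechet_derivative f (at q) (0, 1) * frechet_derivative g (at q) (v, 0))"
  have B_eq: "partial_bracket V f g = (\<lambda>q. B q (V (fst q)))" "\<Phi> = (\<lambda>q. B p (V (fst q)))"
    "C = (\<lambda>q. B q (V (fst p)))"
    by (auto simp: B_def partial_bracket_def \<Phi>_def C_def)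
  have fg2: "Ck_on (Suc (Suc 0)) f A" "Ck_on (Suc (Suc 0)) g A"
    using f g by (auto simp: numeral_2_eq_2)
  have B_diff: "(\<lambda>q. B q v) differentiable (at p)" for v
    unfolding B_def using fg2 A(2)
    by (intro differentiable_diff differentiable_mult) (auto simp del: Ck_on.simps(1))
  have B_lin: "linear (B q)" if "q \<in> A" for q
  proof -
    have l: "linear (\<lambda>v. F (v, 0))" if "linear F" for F :: "'e \<times> real \<Rightarrow> real"
      using linear_compose[OF _ that, of "\<lambda>v. (v, 0)"]
      by (auto simp: linear_iff o_def)
    have "linear (\<lambda>v. frechet_derivative f (at q) (v, 0))" "linear (\<lambda>v. frechet_derivative g (at q) (v, 0))"
      using fg2 that by (auto intro!: l linear_frechet_derivative)
    then show ?thesis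
      unfolding B_def by (auto simp: linear_iff algebra_simps)
  qed
  \<comment> \<open>This is \<open>B q - B p\<close> applied to
    \<open>V (fst q) - V (fst p)\<close>, in coordinates. Each summand is a continuous factor times
    a differentiable one, both zero at \<open>p\<close>, so \<open>R\<close> has derivative
    zero.\<close>
  define R where "R = (\<lambda>q. \<Sum>b\<in>Basis. ((V (fst q) - V (fst p)) \<bullet> b) * (B q b - B p b))"
  have "(R has_derivative (\<lambda>d. \<Sum>b\<in>(Basis::'e set). 0)) (at p)"
    unfolding R_def
  proof (intro has_derivative_sum)
    fix b :: 'e
    obtain B' where "((\<lambda>q. B q b) has_derivative B') (at p)"
      using B_diff by (auto simp: differentiable_def)
    then have "((\<lambda>q. B q b - B p b) has_derivative B') (at p)"
      by (auto intro!: derivative_eq_intros)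
    moreover have "isCont (\<lambda>q. (V (fst q) - V (fst p)) \<bullet> b) p"
      using V by (intro continuous_intros isCont_o2[of p fst V]) auto
    ultimately show "((\<lambda>q. ((V (fst q) - V (fst p)) \<bullet> b) * (B q b - B p b)) has_derivative (\<lambda>_. 0)) (at p)"
      by (intro has_derivative_mult_continuous_zero) auto
  qed
  then have R: "(R has_derivative (\<lambda>_. 0)) (at p)" by simp
  \<comment> \<open>Linearity of \<open>B q\<close> and \<open>B p\<close> expands \<open>R\<close>
    into four terms. Every term on the right is differentiable at \<open>p\<close>, hence so is
    \<Phi>.\<close>
  have split: "\<Phi> q = partial_bracket V f g q - C q + C p - R q" if "q \<in> A" for q
  proof -
    have "R q = B q (V (fst q) - V (fst p)) - B p (V (fst q) - V (fst p))"
      unfolding R_def using B_lin[OF that] B_lin[OF A(2)]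
      by (subst (2 4) euclidean_representation[symmetric])
         (simp add: linear_sum linear_cmul right_diff_distrib sum_subtractf)
    then show ?thesis
      using B_lin[OF that] B_lin[OF A(2)] by (simp add: B_eq linear_diff)
  qed
  obtain C' where C': "(C has_derivative C') (at p)"
    using B_diff unfolding B_eq by (auto simp: differentiable_def)
  let ?P' = "frechet_derivative (partial_bracket V f g) (at p)"
  have "((\<lambda>q. partial_bracket V f g q - C q + C p - R q) has_derivative (\<lambda>d. ?P' d - C' d)) (at p)"
    using diff C' R unfolding frechet_derivative_works
    by (auto intro!: derivative_eq_intros)
  then have \<Phi>': "(\<Phi> has_derivative (\<lambda>d. ?P' d - C' d)) (at p)"
    by (rule has_derivative_transform_within_open[OF _ A]) (simp add: split)
  \<comment> \<open>\<Phi> depends on \<open>q\<close> only through \<open>fst q\<close>, hence is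
    constant along \<open>(0, 1)\<close>.\<close>
  moreover have "?P' (0, 1) - C' (0, 1) = 0"
    by (rule has_derivative_zero_along_line[OF \<Phi>']) (simp add: \<Phi>_def)
  ultimately show ?thesis using C' that by simp
qed

lemma partial_bracket_const_derivative:
  fixes f g :: "'e::real_normed_vector \<times> real \<Rightarrow> real"
  assumes "p \<in> A" and f: "Ck_on 2 f A" and g: "Ck_on 2 g A"
    and C': "(partial_bracket (\<lambda>_. w) f g has_derivative C') (at p)"
  shows "C' d =
    frechet_derivative (\<lambda>q. frechet_derivative f (at q) (w, 0)) (at p) d * frechet_derivative g (at p) (0, 1) +
    frechet_derivative f (at p) (w, 0) * frechet_derivative (\<lambda>q. frechet_derivative g (at q) (0, 1)) (at p) d -
    frechet_derivative (\<lambda>q. frechet_derivative f (at q) (0, 1)) (at p) d * frechet_derivative g (at p) (w, 0) -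
    frechet_derivative f (at p) (0, 1) * frechet_derivative (\<lambda>q. frechet_derivative g (at q) (w, 0)) (at p) d"
proof -
  have "((\<lambda>q. frechet_derivative F (at q) v) has_derivative
      frechet_derivative (\<lambda>q. frechet_derivative F (at q) v) (at p)) (at p)"
    if "Ck_on 2 F A" for F v
    using that assms(1) by (simp add: frechet_derivative_works[symmetric] numeral_2_eq_2 del: split_paired_All)
  note D = this[OF f] this[OF g]
  have "(partial_bracket (\<lambda>_. w) f g has_derivative (\<lambda>d.
    frechet_derivative (\<lambda>q. frechet_derivative f (at q) (w, 0)) (at p) d * frechet_derivative g (at p) (0, 1) +
    frechet_derivative f (at p) (w, 0) * frechet_derivative (\<lambda>q. frechet_derivative g (at q) (0, 1)) (at p) d -
    frechet_derivative (\<lambda>q. frechet_derivative f (at q) (0, 1)) (at p) d * frechet_derivative g (at p) (w, 0) -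
    frechet_derivative f (at p) (0, 1) * frechet_derivative (\<lambda>q. frechet_derivative g (at q) (w, 0)) (at p) d)) (at p)"
    unfolding partial_bracket_def[abs_def]
    by (rule has_derivative_eq_rhs, (rule D has_derivative_diff has_derivative_mult)+) (auto simp: fun_eq_iff)
  from has_derivative_unique[OF C' this] show ?thesis by simp
qed

lemma partial_bracket_jacobi:
  fixes V :: "'e::euclidean_space \<Rightarrow> 'e" and f g h :: "'e \<times> real \<Rightarrow> real"
  assumes A: "open A" "p \<in> A" and f: "Ck_on 2 f A" and g: "Ck_on 2 g A" and h: "Ck_on 2 h A"
    and V: "isCont V (fst p)"
    and fg: "partial_bracket V f g differentiable (at p)"
    and hf: "partial_bracket V h f differentiable (at p)"
    and gh: "partial_bracket V g h differentiable (at p)"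
  shows "partial_bracket V (partial_bracket V f g) h p +
         partial_bracket V (partial_bracket V h f) g p +
         partial_bracket V (partial_bracket V g h) f p = 0"
proof -
  define w where "w = V (fst p)"
  let ?D = "\<lambda>f. frechet_derivative f (at p)"
  let ?E = "(0, 1) :: 'e \<times> real"
  define Fr :: "('e \<times> real \<Rightarrow> real) \<Rightarrow> ('e \<times> real \<Rightarrow> real) \<Rightarrow> 'e \<times> real \<Rightarrow> real"
    where "Fr = (\<lambda>f g q. ?D f (V (fst q), 0) * ?D g ?E - ?D f ?E * ?D g (V (fst q), 0))"
  obtain P1 C1 where 1: "(Fr f g has_derivative P1) (at p)"
    "(partial_bracket (\<lambda>_. w) f g has_derivative C1) (at p)"
    "?D (partial_bracket V f g) = (\<lambda>d. P1 d + C1 d)" "P1 ?E = 0"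
    using partial_bracket_derivative[OF A f g V fg] unfolding Fr_def w_def by blast
  obtain P2 C2 where 2: "(Fr h f has_derivative P2) (at p)"
    "(partial_bracket (\<lambda>_. w) h f has_derivative C2) (at p)"
    "?D (partial_bracket V h f) = (\<lambda>d. P2 d + C2 d)" "P2 ?E = 0"
    using partial_bracket_derivative[OF A h f V hf] unfolding Fr_def w_def by blast
  obtain P3 C3 where 3: "(Fr g h has_derivative P3) (at p)"
    "(partial_bracket (\<lambda>_. w) g h has_derivative C3) (at p)"
    "?D (partial_bracket V g h) = (\<lambda>d. P3 d + C3 d)" "P3 ?E = 0"
    using partial_bracket_derivative[OF A g h V gh] unfolding Fr_def w_def by blast
  \<comment> \<open>The weights are the factors that the outer brackets put on the inner derivatives
    along \<open>(w, 0)\<close>. The weighted sum of the \<open>Fr\<close> terms is zero as a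
    function of \<open>q\<close>, so its derivative vanishes.\<close>
  have "((\<lambda>q. ?D h ?E * Fr f g q + ?D g ?E * Fr h f q + ?D f ?E * Fr g h q) has_derivative
      (\<lambda>d. ?D h ?E * P1 d + ?D g ?E * P2 d + ?D f ?E * P3 d)) (at p)"
    using 1(1) 2(1) 3(1) by (auto intro!: derivative_eq_intros)
  moreover have "(\<lambda>q. ?D h ?E * Fr f g q + ?D g ?E * Fr h f q + ?D f ?E * Fr g h q) = (\<lambda>_. 0)"
    by (simp add: Fr_def fun_eq_iff algebra_simps)
  ultimately have "((\<lambda>_. 0) has_derivative (\<lambda>d. ?D h ?E * P1 d + ?D g ?E * P2 d + ?D f ?E * P3 d)) (at p)"
    by simp
  from fun_cong[OF has_derivative_unique[OF this has_derivative_const], of "(w, 0)"]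
  have P: "?D h ?E * P1 (w, 0) + ?D g ?E * P2 (w, 0) + ?D f ?E * P3 (w, 0) = 0" .
  have c: "?D (\<lambda>q. frechet_derivative F (at q) ?E) (w, 0) = ?D (\<lambda>q. frechet_derivative F (at q) (w, 0)) ?E"
    if "Ck_on 2 F A" for F :: "'e \<times> real \<Rightarrow> real"
    by (rule Ck_on_2_mixed_derivatives[OF A that])
  note C = partial_bracket_const_derivative[OF A(2) f g 1(2)]
    partial_bracket_const_derivative[OF A(2) h f 2(2)]
    partial_bracket_const_derivative[OF A(2) g h 3(2)]
  \<comment> \<open>This is the Jacobi identity for the constant field \<open>w\<close>: after the
    product rule, the second derivatives cancel once the mixed ones are identified by
    \<open>c\<close>.\<close>
  have "?D h ?E * C1 (w, 0) + ?D g ?E * C2 (w, 0) + ?D f ?E * C3 (w, 0) =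
    C1 ?E * ?D h (w, 0) + C2 ?E * ?D g (w, 0) + C3 ?E * ?D f (w, 0)"
    unfolding C c[OF f] c[OF g] c[OF h] by (simp add: algebra_simps)
  with P show ?thesis
    unfolding partial_bracket_def[of V "partial_bracket V f g"] partial_bracket_def[of V "partial_bracket V h f"]
      partial_bracket_def[of V "partial_bracket V g h"] 1(3) 2(3) 3(3) 1(4) 2(4) 3(4) w_def[symmetric]
    by (simp add: algebra_simps)
qed

section \<open>Charts of the product with the real line\<close>

text \<open>Applied with \<open>fst\<close> and \<open>snd\<close>, this extracts the components of
  the maps in \<open>Ck_on_times_line\<close>, which represent \<open>S_hat S\<close> and
  \<open>E_hat\<close> in a chart.\<close>

lemma Ck_on_bounded_linear:
  assumes "bounded_linear l" "open A" "Ck_on k f A"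
  shows "Ck_on k (l \<circ> f) A"
  using assms(3)
proof (induction k arbitrary: f)
  case 0
  then show ?case
    using assms(1) by (auto simp: o_def intro: bounded_linear.continuous_on)
next
  case (Suc k)
  have d: "((l \<circ> f) has_derivative l \<circ> frechet_derivative f (at x)) (at x)" if "x \<in> A" for x
    unfolding o_def using Suc.prems that
    by (intro bounded_linear.has_derivative[OF assms(1)]) (simp add: frechet_derivative_works)
  show ?case
  proof (simp only: Ck_on.simps, intro conjI allI ballI)
    show "(l \<circ> f) differentiable at x" if "x \<in> A" for x
      using d[OF that] by (auto simp: differentiable_def)
    show "Ck_on k (\<lambda>x. frechet_derivative (l \<circ> f) (at x) v) A" for v
    proof (rule Ck_on_cong[OF assms(2)])
      show "Ck_on k (l \<circ> (\<lambda>x. frechet_derivative f (at x) v)) A"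
        using Suc.prems by (intro Suc.IH) simp
      show "(l \<circ> (\<lambda>x. frechet_derivative f (at x) v)) x = frechet_derivative (l \<circ> f) (at x) v" if "x \<in> A" for x
        using frechet_derivative_at[OF d[OF that]] by (metis comp_apply)
    qed
  qed
qed

lemma Ck_on_1_differentiable: "Ck_on 1 f A \<Longrightarrow> x \<in> A \<Longrightarrow> f differentiable (at x)"
  by (simp add: One_nat_def)

lemma chart_inv_apply:
  assumes "is_chart c" "z \<in> fst c" shows "chart_inv c (snd c z) = z"
  using assms by (auto simp: is_chart_def homeomorphism_def)

lemma apply_chart_inv:
  assumes "is_chart c" "x \<in> chart_image c" shows "snd c (chart_inv c x) = x" "chart_inv c x \<in> fst c"
  using assms by (auto simp: is_chart_def homeomorphism_def)

lemma has_derivative_transform_chart: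
  assumes "(f has_derivative f') (at x)" "is_chart c" "x \<in> chart_image c"
    and "\<And>y. y \<in> chart_image c \<Longrightarrow> f y = g y"
  shows "(g has_derivative f') (at x)"
  using assms(2-4) by (intro has_derivative_transform_within_open[OF assms(1)]) (auto simp: is_chart_def)

lemma transition_differentiable:
  assumes M: "smooth_manifold M" and c: "c \<in> atlas M" "z \<in> fst c" and d: "d \<in> atlas M" "z \<in> fst d"
  shows "(snd d \<circ> chart_inv c) differentiable (at (snd c z))"
proof (rule Ck_on_1_differentiable)
  show "Ck_on 1 (snd d \<circ> chart_inv c) (snd c ` (fst c \<inter> fst d))"
    using M c d by (simp add: smooth_manifold_def del: One_nat_def)
qed (use c d in auto)

lemma smooth_manifoldD:
  assumes "smooth_manifold M"
  shows "c \<in> atlas M \<Longrightarrow> is_chart c" "pref_chart M z \<in> atlas M" "z \<in> fst (pref_chart M z)"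
  using assms by (auto simp: smooth_manifold_def)

text \<open>Transition maps of the product are the old ones times the identity of the line, so their
  derivatives are block diagonal. Both changes of components, \<open>to_chart\<close> and
  \<open>from_chart\<close>, are instances.\<close>

lemma transition_times_line:
  assumes M: "smooth_manifold M" and c: "c \<in> atlas M" "z \<in> fst c" and d: "d \<in> atlas M" "z \<in> fst d"
  shows "frechet_derivative (snd (chart_times_line d) \<circ> chart_inv (chart_times_line c)) (at (snd c z, a)) =
    (\<lambda>(v, s). (frechet_derivative (snd d \<circ> chart_inv c) (at (snd c z)) v, s))"
proof -
  let ?T = "snd d \<circ> chart_inv c"
  have ch: "is_chart c" using smooth_manifoldD(1)[OF M c(1)] .
  have "(?T has_derivative frechet_derivative ?T (at (fst (snd c z, a)))) (at (fst (snd c z, a)))"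
    using transition_differentiable[OF M c d] by (simp add: frechet_derivative_works)
  from has_derivative_compose[OF has_derivative_fst[OF has_derivative_ident] this]
  have "((\<lambda>p. (?T (fst p), snd p)) has_derivative
      (\<lambda>(v, s). (frechet_derivative ?T (at (snd c z)) v, s))) (at (snd c z, a))"
    by (auto intro!: derivative_eq_intros)
  then have "((snd (chart_times_line d) \<circ> chart_inv (chart_times_line c)) has_derivative
      (\<lambda>(v, s). (frechet_derivative ?T (at (snd c z)) v, s))) (at (snd c z, a))"
    by (rule has_derivative_transform_chart[OF _ is_chart_times_line[OF ch]])
       (use c in \<open>auto simp: chart_inv_times_line[OF ch] chart_image_def\<close>)
  then show ?thesis using frechet_derivative_at by metis
qed

lemma times_line_simps [simp]:
  "atlas (times_line M) = chart_times_line ` atlas M"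
  "pref_chart (times_line M) (z, a) = chart_times_line (pref_chart M z)"
  by (auto simp: times_line_def)

lemma to_chart_times_line:
  assumes "smooth_manifold M" "c \<in> atlas M" "z \<in> fst c"
  shows "to_chart (times_line M) (chart_times_line c) (z, a) = (\<lambda>(v, s). (to_chart M c z v, s))"
  using transition_times_line[OF assms(1) smooth_manifoldD(2,3)[OF assms(1)] assms(2,3)]
  by (simp add: to_chart_def)

lemma from_chart_times_line:
  assumes "smooth_manifold M" "c \<in> atlas M" "z \<in> fst c"
  shows "from_chart (times_line M) (chart_times_line c) (z, a) = (\<lambda>(v, s). (from_chart M c z v, s))"
  using transition_times_line[OF assms smooth_manifoldD(2,3)[OF assms(1)]]
  by (simp add: from_chart_def)

lemma linear_to_chart:
  assumes "smooth_manifold M" "c \<in> atlas M" "z \<in> fst c"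
  shows "linear (to_chart M c z)"
  unfolding to_chart_def
  by (rule linear_frechet_derivative[OF
        transition_differentiable[OF assms(1) smooth_manifoldD(2,3)[OF assms(1)] assms(2,3)]])

lemma adjoint_times_line:
  fixes T :: "'e::euclidean_space \<Rightarrow> 'e"
  assumes "linear T"
  shows "adjoint (\<lambda>(v, s::real). (T v, s)) = (\<lambda>(\<eta>, r). (adjoint T \<eta>, r))"
  by (rule adjoint_unique) (auto simp: adjoint_works[OF assms])

section \<open>Differentials in charts and the lifted functions\<close>

lemma differential_inner:
  assumes "differentiable_pt M f z"
  shows "differential M f z \<bullet> v =
    frechet_derivative (f \<circ> chart_inv (pref_chart M z)) (at (snd (pref_chart M z) z)) v"
proof -
  let ?D = "frechet_derivative (f \<circ> chart_inv (pref_chart M z)) (at (snd (pref_chart M z) z))"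
  have l: "linear ?D" using assms by (simp add: differentiable_pt_def linear_frechet_derivative)
  have "?D v = ?D (\<Sum>b\<in>Basis. (v \<bullet> b) *\<^sub>R b)" by (simp add: euclidean_representation)
  also have "\<dots> = (\<Sum>b\<in>Basis. (v \<bullet> b) * ?D b)" using l by (simp add: linear_sum linear_cmul)
  finally show ?thesis
    by (simp add: differential_def inner_sum_left inner_commute[of v] mult.commute)
qed

lemma Ck_fun_differentiable:
  assumes M: "smooth_manifold M" and f: "Ck_fun 1 M f" and c: "c \<in> atlas M" "z \<in> fst c"
  shows "(f \<circ> chart_inv c) differentiable (at (snd c z))"
proof (rule Ck_on_1_differentiable)
  show "Ck_on 1 (f \<circ> chart_inv c) (chart_image c)"
    using f c by (simp add: Ck_fun_def del: One_nat_def)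
qed (use c in \<open>auto simp: chart_image_def\<close>)

lemma Ck_fun_differentiable_pt:
  assumes "smooth_manifold M" "Ck_fun 1 M f" shows "differentiable_pt M f z"
  unfolding differentiable_pt_def by (rule Ck_fun_differentiable[OF assms smooth_manifoldD(2,3)[OF assms(1)]])

text \<open>\<open>differential\<close> uses the preferred chart, which may jump from point to
  point. The chain rule through the transition map moves the pairing to one fixed chart, where it
  can be differentiated again.\<close>

lemma differential_in_chart:
  assumes M: "smooth_manifold M" and f: "Ck_fun 1 M f" and c: "c \<in> atlas M" "z \<in> fst c"
  shows "differential M f z \<bullet> v = frechet_derivative (f \<circ> chart_inv c) (at (snd c z)) (to_chart M c z v)"
proof -
  let ?p = "pref_chart M z"
  have p: "?p \<in> atlas M" "z \<in> fst ?p" "is_chart ?p" "chart_inv ?p (snd ?p z) = z"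
    using smooth_manifoldD[OF M] chart_inv_apply by blast+
  have ch: "is_chart c" using smooth_manifoldD(1)[OF M c(1)] .
  have T: "(snd c \<circ> chart_inv ?p) differentiable (at (snd ?p z))"
    by (rule transition_differentiable[OF M p(1,2) c])
  have e: "(snd c \<circ> chart_inv ?p) (snd ?p z) = snd c z" using p(4) by simp
  have F: "(f \<circ> chart_inv c) differentiable (at ((snd c \<circ> chart_inv ?p) (snd ?p z)))"
    unfolding e by (rule Ck_fun_differentiable[OF M f c])
  have o: "open (snd ?p ` (fst ?p \<inter> fst c))"
    using p(3) ch by (intro is_chart_image) (auto simp: is_chart_def)
  have "((f \<circ> chart_inv c) \<circ> (snd c \<circ> chart_inv ?p) has_derivative
     frechet_derivative (f \<circ> chart_inv c) (at (snd c z)) \<circ> to_chart M c z) (at (snd ?p z))"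
    unfolding to_chart_def using diff_chain_at[OF T[unfolded frechet_derivative_works] F[unfolded frechet_derivative_works]]
    by (simp only: e)
  then have "((f \<circ> chart_inv ?p) has_derivative
     frechet_derivative (f \<circ> chart_inv c) (at (snd c z)) \<circ> to_chart M c z) (at (snd ?p z))"
    by (rule has_derivative_transform_within_open[OF _ o])
       (use p c in \<open>auto simp: chart_inv_apply[OF p(3)] chart_inv_apply[OF ch]\<close>)
  then show ?thesis
    using differential_inner[OF Ck_fun_differentiable_pt[OF M f]] frechet_derivative_at by (metis comp_apply)
qed

lemma Ck_fun_S_hat:
  assumes M: "smooth_manifold M" and S: "Ck_fun k M S"
  shows "Ck_fun k (times_line M) (S_hat S)"
  unfolding Ck_fun_def
proof (clarsimp)
  fix c assume c: "c \<in> atlas M"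
  have ch: "is_chart c" using smooth_manifoldD(1)[OF M c] .
  have o: "open (chart_image c)" using ch by (simp add: is_chart_def)
  have "Ck_on k (S \<circ> chart_inv c) (chart_image c)" using S c by (simp add: Ck_fun_def)
  from Ck_on_bounded_linear[OF bounded_linear_fst _ Ck_on_times_line[OF o this, of 1 0]]
  show "Ck_on k (S_hat S \<circ> chart_inv (chart_times_line c)) (chart_image c \<times> UNIV)"
    by (rule Ck_on_cong[rotated 2])
       (use o in \<open>auto simp: open_Times S_hat_def chart_inv_times_line[OF ch]\<close>)
qed

lemma Ck_fun_E_hat:
  assumes M: "smooth_manifold M"
  shows "Ck_fun k (times_line M) E_hat"
  unfolding Ck_fun_def
proof (clarsimp)
  fix c assume c: "c \<in> atlas M"
  have ch: "is_chart c" using smooth_manifoldD(1)[OF M c] .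
  have o: "open (chart_image c)" using ch by (simp add: is_chart_def)
  \<comment> \<open>\<open>Ck_on_times_line\<close> starts from some \<open>C^k\<close> first
    component. The transition of \<open>c\<close> with itself supplies one, and \<open>snd\<close>
    then keeps only the line coordinate.\<close>
  have "Ck_on k (snd c \<circ> chart_inv c) (snd c ` (fst c \<inter> fst c))"
    using M c unfolding smooth_manifold_def by blast
  then have "Ck_on k (snd c \<circ> chart_inv c) (chart_image c)" by (simp add: chart_image_def)
  from Ck_on_bounded_linear[OF bounded_linear_snd _ Ck_on_times_line[OF o this, of 1 0]]
  show "Ck_on k (E_hat \<circ> chart_inv (chart_times_line c)) (chart_image c \<times> UNIV)"
    by (rule Ck_on_cong[rotated 2])
       (use o in \<open>auto simp: open_Times E_hat_def chart_inv_times_line[OF ch]\<close>)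
qed

lemma differential_eqI:
  assumes M: "smooth_manifold M"
    and D: "((f \<circ> chart_inv (pref_chart M z)) has_derivative (\<lambda>v. w \<bullet> v)) (at (snd (pref_chart M z) z))"
  shows "differential M f z = w"
proof -
  have "differential M f z \<bullet> v = w \<bullet> v" for v
    using D frechet_derivative_at[OF D] by (subst differential_inner) (auto simp: differentiable_pt_def differentiable_def)
  then show ?thesis by (metis vector_eq_rdot)
qed

lemma differential_S_hat:
  assumes M: "smooth_manifold M" and S: "Ck_fun 1 M S"
  shows "differential (times_line M) (S_hat S) (z, a) = (differential M S z, 0)"
proof (rule differential_eqI[OF smooth_manifold_times_line[OF M]])
  let ?p = "pref_chart M z"
  have p: "is_chart ?p" "z \<in> fst ?p" using smooth_manifoldD[OF M] by blast+
  have "((S \<circ> chart_inv ?p) has_derivative (\<lambda>v. differential M S z \<bullet> v)) (at (fst (snd ?p z, a)))"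
    using Ck_fun_differentiable_pt[OF M S, of z]
    by (simp add: differential_inner) (simp add: differentiable_pt_def frechet_derivative_works)
  from has_derivative_compose[OF has_derivative_fst[OF has_derivative_ident] this]
  have d: "((\<lambda>q. (S \<circ> chart_inv ?p) (fst q)) has_derivative (\<lambda>v. (differential M S z, 0) \<bullet> v)) (at (snd ?p z, a))"
    by (simp add: inner_prod_def)
  show "(S_hat S \<circ> chart_inv (pref_chart (times_line M) (z, a)) has_derivative
      (\<lambda>v. (differential M S z, 0) \<bullet> v)) (at (snd (pref_chart (times_line M) (z, a)) (z, a)))"
    by (simp, rule has_derivative_transform_chart[OF d is_chart_times_line[OF p(1)]])
       (use p in \<open>auto simp: S_hat_def chart_inv_times_line chart_image_def\<close>)
qed

lemma differential_E_hat:
  assumes M: "smooth_manifold M"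
  shows "differential (times_line M) E_hat (z, a) = (0, 1)"
proof (rule differential_eqI[OF smooth_manifold_times_line[OF M]])
  let ?p = "pref_chart M z"
  have p: "is_chart ?p" "z \<in> fst ?p" using smooth_manifoldD[OF M] by blast+
  have "(snd has_derivative snd) (at (snd ?p z, a))"
    by (rule bounded_linear_imp_has_derivative[OF bounded_linear_snd])
  then have d: "(snd has_derivative (\<lambda>v. (0, 1) \<bullet> v)) (at (snd ?p z, a))"
    by (simp add: inner_prod_def)
  show "(E_hat \<circ> chart_inv (pref_chart (times_line M) (z, a)) has_derivative
      (\<lambda>v. (0, 1) \<bullet> v)) (at (snd (pref_chart (times_line M) (z, a)) (z, a)))"
    by (simp, rule has_derivative_transform_chart[OF d is_chart_times_line[OF p(1)]])
       (use p in \<open>auto simp: E_hat_def chart_inv_times_line chart_image_def\<close>)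
qed

lemma vector_field_F_hat:
  assumes M: "smooth_manifold M" and F: "vector_field M F"
  shows "vector_field (times_line M) (F_hat F)"
  unfolding vector_field_def
proof (simp, intro ballI)
  fix c assume c: "c \<in> atlas M"
  have "continuous_on (fst c) (\<lambda>z. to_chart M c z (F z))" using F c by (simp add: vector_field_def)
  then have "continuous_on (fst c \<times> (UNIV::real set)) (\<lambda>p. (to_chart M c (fst p) (F (fst p)), 0::real))"
    by (intro continuous_intros continuous_on_compose2[of "fst c" _ _ fst]) auto
  then show "continuous_on (fst c \<times> UNIV) (\<lambda>z. to_chart (times_line M) (chart_times_line c) z (F_hat F z))"
    by (rule continuous_on_eq) (auto simp: to_chart_times_line[OF M c] F_hat_def)
qed

section \<open>The Jacobi identity on the product\<close>

lemma antisymmetric_L_hat: "antisymmetric (L_hat W)"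
  by (auto simp: antisymmetric_def L_hat_def)

text \<open>\<open>L_hat W\<close> is the bivector of \<open>W\<close> and the line direction. On
  differentials this form consists of derivatives along \<open>(W z, 0)\<close> and
  \<open>(0, 1)\<close>, as in \<open>partial_bracket\<close>.\<close>

lemma L_hat_inner: "L_hat W (z, a) \<eta> \<bullet> \<xi> = (\<xi> \<bullet> (W z, 0)) * (\<eta> \<bullet> (0, 1)) - (\<xi> \<bullet> (0, 1)) * (\<eta> \<bullet> (W z, 0))"
  by (cases \<eta>; cases \<xi>) (auto simp: L_hat_def inner_commute)

lemma jacobi_identity_L_hat:
  assumes M: "smooth_manifold M" and W: "vector_field M W"
  shows "jacobi_identity (times_line M) (L_hat W)"
  unfolding jacobi_identity_def
proof (intro allI impI)
  let ?N = "times_line M"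
  fix F1 F2 F3 and p :: "'a \<times> real"
  assume smooth: "smooth_fun ?N F1" "smooth_fun ?N F2" "smooth_fun ?N F3"
  obtain z a where p: "p = (z, a)" by (cases p)
  \<comment> \<open>With the preferred chart at \<open>z\<close>, components at \<open>p\<close>
    agree with components in the chart. Elsewhere in its domain they are converted by
    \<open>to_chart\<close>.\<close>
  define c where "c = pref_chart M z"
  define x where "x = (snd c z, a)"
  define V where "V = (\<lambda>x. to_chart M c (chart_inv c x) (W (chart_inv c x)))"
  define loc where "loc = (\<lambda>G :: 'a \<times> real \<Rightarrow> real. G \<circ> chart_inv (chart_times_line c))"
  let ?A = "chart_image c \<times> (UNIV :: real set)"
  have N: "smooth_manifold ?N" by (rule smooth_manifold_times_line[OF M])
  have c: "c \<in> atlas M" "z \<in> fst c" "is_chart c"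
    using smooth_manifoldD[OF M] unfolding c_def by blast+
  have A: "open ?A" "x \<in> ?A" using c by (auto simp: is_chart_def x_def chart_image_def open_Times)
  have Vz: "V (fst x) = W z"
    unfolding V_def x_def fst_conv chart_inv_apply[OF c(3,2)] using to_chart_pref[OF M, of z] by (simp add: c_def)
  have "continuous_on (fst c) (\<lambda>z. to_chart M c z (W z))" using W c by (simp add: vector_field_def)
  moreover have "homeomorphism (fst c) (chart_image c) (snd c) (chart_inv c)" and o: "open (chart_image c)"
    using c(3) by (simp_all add: is_chart_def)
  then have "continuous_on (chart_image c) (chart_inv c)" "chart_inv c ` chart_image c \<subseteq> fst c"
    by (simp_all add: homeomorphism_def)
  ultimately have "continuous_on (chart_image c) V"
    unfolding V_def by (rule continuous_on_compose2)
  then have V: "isCont V (fst x)" using A(2) unfolding continuous_on_eq_continuous_at[OF o] by auto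
  have pref: "pref_chart ?N p = chart_times_line c" "snd (chart_times_line c) p = x"
    by (auto simp: p c_def x_def)
  have C2: "Ck_on 2 (loc G) ?A" and C1: "Ck_fun 1 ?N G" if "smooth_fun ?N G" for G
  proof -
    show "Ck_fun 1 ?N G" using that by (simp only: smooth_fun_def)
    have "Ck_fun 2 ?N G" using that by (simp only: smooth_fun_def)
    then have "\<forall>d\<in>atlas ?N. Ck_on 2 (G \<circ> chart_inv d) (chart_image d)" by (simp only: Ck_fun_def)
    moreover have "chart_times_line c \<in> atlas ?N" using c(1) by simp
    ultimately show "Ck_on 2 (loc G) ?A" unfolding loc_def by (metis chart_times_line_simps(3))
  qed
  \<comment> \<open>The brackets are compared on the whole chart image, since both are
    differentiated afterwards. The conversion of \<open>W\<close> to components in \<open>c\<close>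
    is absorbed in \<open>V\<close>.\<close>
  have br: "loc (bracket ?N (L_hat W) G H) q = partial_bracket V (loc G) (loc H) q"
    if GH: "smooth_fun ?N G" "smooth_fun ?N H" and "q \<in> ?A" for G H q
  proof -
    obtain y b where q: "q = (y, b)" "y \<in> chart_image c" using \<open>q \<in> ?A\<close> by blast
    let ?z = "chart_inv c y"
    have y: "snd c ?z = y" "?z \<in> fst c" using apply_chart_inv[OF c(3) q(2)] by auto
    have D: "differential ?N G (?z, b) \<bullet> (v, s) = frechet_derivative (loc G) (at (y, b)) (to_chart M c ?z v, s)"
      if "smooth_fun ?N G" for G v s
      using differential_in_chart[OF N C1[OF that], of "chart_times_line c" "(?z, b)" "(v, s)"] c y
      by (simp add: loc_def to_chart_times_line[OF M c(1) y(2)])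
    have "to_chart M c ?z 0 = 0" by (rule linear_0[OF linear_to_chart[OF M c(1) y(2)]])
    moreover have "loc K q = K (?z, b)" for K
      unfolding q loc_def by (simp add: chart_inv_times_line[OF c(3) q(2)])
    ultimately show ?thesis
      unfolding q(1) bracket_def L_hat_inner partial_bracket_def V_def
      by (simp add: D[OF GH(1)] D[OF GH(2)] q(1) bracket_def L_hat_inner)
  qed
  have D: "partial_bracket V (loc G) (loc H) differentiable (at x)"
    "frechet_derivative (loc (bracket ?N (L_hat W) G H)) (at x) =
       frechet_derivative (partial_bracket V (loc G) (loc H)) (at x)"
    if diff: "differentiable_pt ?N (bracket ?N (L_hat W) G H) p"
      and GH: "smooth_fun ?N G" "smooth_fun ?N H" for G H
  proof -
    have "(loc (bracket ?N (L_hat W) G H) has_derivative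
        frechet_derivative (loc (bracket ?N (L_hat W) G H)) (at x)) (at x)"
      using diff unfolding differentiable_pt_def pref loc_def by (simp only: frechet_derivative_works)
    then have *: "(partial_bracket V (loc G) (loc H) has_derivative
        frechet_derivative (loc (bracket ?N (L_hat W) G H)) (at x)) (at x)"
      by (rule has_derivative_transform_within_open[OF _ A]) (rule br[OF GH])
    then show "partial_bracket V (loc G) (loc H) differentiable (at x)" by (auto simp: differentiable_def)
    show "frechet_derivative (loc (bracket ?N (L_hat W) G H)) (at x) =
       frechet_derivative (partial_bracket V (loc G) (loc H)) (at x)"
      by (rule frechet_derivative_at[OF *])
  qed
  have nested: "bracket ?N (L_hat W) (bracket ?N (L_hat W) G H) K p =
      partial_bracket V (partial_bracket V (loc G) (loc H)) (loc K) x"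
    if diff: "differentiable_pt ?N (bracket ?N (L_hat W) G H) p"
      and GHK: "smooth_fun ?N G" "smooth_fun ?N H" "smooth_fun ?N K" for G H K
  proof -
    \<comment> \<open>\<open>differential_in_chart\<close> asks for \<open>C^1\<close>, while the
      inner bracket is only known to be differentiable at \<open>p\<close>. There the chart is the
      preferred one, so \<open>differential_inner\<close> suffices.\<close>
    have "differential ?N (bracket ?N (L_hat W) G H) p \<bullet> v =
        frechet_derivative (partial_bracket V (loc G) (loc H)) (at x) v" for v
      using differential_inner[OF diff] D(2)[OF diff GHK(1,2)] by (simp only: pref loc_def)
    moreover have "differential ?N K p \<bullet> v = frechet_derivative (loc K) (at x) v" for v
      using differential_inner[OF Ck_fun_differentiable_pt[OF N C1[OF GHK(3)]]] by (simp only: pref loc_def)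
    ultimately show ?thesis
      by (simp add: bracket_def[of _ _ "bracket _ _ _ _"] p L_hat_inner partial_bracket_def[of _ "partial_bracket _ _ _"] Vz)
  qed
  assume d: "differentiable_pt ?N (bracket ?N (L_hat W) F1 F2) p"
    "differentiable_pt ?N (bracket ?N (L_hat W) F3 F1) p"
    "differentiable_pt ?N (bracket ?N (L_hat W) F2 F3) p"
  show "bracket ?N (L_hat W) (bracket ?N (L_hat W) F1 F2) F3 p +
        bracket ?N (L_hat W) (bracket ?N (L_hat W) F3 F1) F2 p +
        bracket ?N (L_hat W) (bracket ?N (L_hat W) F2 F3) F1 p = 0"
    unfolding nested[OF d(1) smooth] nested[OF d(2) smooth(3,1,2)] nested[OF d(3) smooth(2,3,1)]
    by (rule partial_bracket_jacobi[OF A C2[OF smooth(1)] C2[OF smooth(2)] C2[OF smooth(3)] V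
          D(1)[OF d(1) smooth(1,2)] D(1)[OF d(2) smooth(3,1)] D(1)[OF d(3) smooth(2,3)]])
qed

section \<open>Potentials on the product with the real line\<close>

text \<open>The Legendre dual of a function independent of \<open>r\<close> has this shape, because
  the supremum of \<open>r * s\<close> over \<open>r\<close> is 0 for \<open>s = 0\<close> and
  \<infinity> otherwise.\<close>

definition tangent_hat :: "('a \<Rightarrow> 'e \<Rightarrow> ereal) \<Rightarrow> 'a \<times> real \<Rightarrow> 'e \<times> real \<Rightarrow> ereal" where
  "tangent_hat f = (\<lambda>(z, a) (v, s). if s = 0 then f z v else \<infinity>)"

lemma tangent_hat_simps [simp]: "tangent_hat f (z, a) (v, s) = (if s = 0 then f z v else \<infinity>)"
  by (simp add: tangent_hat_def)

lemma cotangent_hat_simps [simp]: "cotangent_hat H (z, a) (\<xi>, r) = H z \<xi>"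
  by (simp add: cotangent_hat_def)

section \<open>Legendre duals of the lifted functions\<close>

lemma legendre_cotangent_hat:
  fixes g :: "'a \<Rightarrow> 'e::real_inner \<Rightarrow> real"
  shows "legendre (\<lambda>p \<eta>. ereal (cotangent_hat g p \<eta>)) = tangent_hat (legendre (\<lambda>z \<xi>. ereal (g z \<xi>)))"
proof (intro ext)
  fix p :: "'a \<times> real" and w :: "'e \<times> real"
  obtain z a v s where pw: "p = (z, a)" "w = (v, s)" by (cases p; cases w)
  let ?f = "\<lambda>\<eta>. ereal (\<eta> \<bullet> w) - ereal (cotangent_hat g p \<eta>)"
  show "legendre (\<lambda>p \<eta>. ereal (cotangent_hat g p \<eta>)) p w = tangent_hat (legendre (\<lambda>z \<xi>. ereal (g z \<xi>))) p w"
  proof (cases "s = 0")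
    case True
    have "(SUP \<eta>. ?f \<eta>) = (SUP \<xi>. ereal (\<xi> \<bullet> v) - ereal (g z \<xi>))"
    proof (intro antisym SUP_least)
      fix \<eta> :: "'e \<times> real"
      show "?f \<eta> \<le> (SUP \<xi>. ereal (\<xi> \<bullet> v) - ereal (g z \<xi>))"
        by (cases \<eta>) (auto simp: pw True intro!: SUP_upper2)
    next
      fix \<xi> show "ereal (\<xi> \<bullet> v) - ereal (g z \<xi>) \<le> (SUP \<eta>. ?f \<eta>)"
        by (rule SUP_upper2[of "(\<xi>, 0)"]) (auto simp: pw)
    qed
    then show ?thesis by (simp add: legendre_def pw True)
  next
    case False
    have "(SUP \<eta>. ?f \<eta>) = \<infinity>"
    proof (rule SUP_PInfty)
      fix n :: nat
      show "\<exists>\<eta>\<in>UNIV. ereal (real n) \<le> ?f \<eta>"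
        \<comment> \<open>The second component solves \<open>r * s = real n + g z 0\<close>, so the
          difference is exactly \<open>n\<close>.\<close>
        by (rule bexI[of _ "(0, (real n + g z 0) / s)"]) (use False in \<open>auto simp: pw\<close>)
    qed
    then show ?thesis by (simp add: legendre_def pw False)
  qed
qed

text \<open>Vectors with \<open>s \<noteq> 0\<close> contribute \<open>-\<infinity>\<close> to the
  supremum. On those with \<open>s = 0\<close> the pairing does not see \<open>r\<close>.\<close>

lemma legendre_tangent_hat:
  fixes f :: "'a \<Rightarrow> 'e::real_inner \<Rightarrow> ereal"
  shows "legendre (tangent_hat f) = cotangent_hat (legendre f)"
proof (intro ext)
  fix p :: "'a \<times> real" and \<eta> :: "'e \<times> real"
  obtain z a \<xi> r where p\<eta>: "p = (z, a)" "\<eta> = (\<xi>, r)" by (cases p; cases \<eta>)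
  let ?g = "\<lambda>w. ereal (w \<bullet> \<eta>) - tangent_hat f p w"
  have "(SUP w. ?g w) = (SUP v. ereal (v \<bullet> \<xi>) - f z v)"
  proof (intro antisym SUP_least)
    fix w :: "'e \<times> real"
    show "?g w \<le> (SUP v. ereal (v \<bullet> \<xi>) - f z v)"
      by (cases w) (auto simp: p\<eta> intro!: SUP_upper2)
  next
    fix v show "ereal (v \<bullet> \<xi>) - f z v \<le> (SUP w. ?g w)"
      by (rule SUP_upper2[of "(v, 0)"]) (auto simp: p\<eta>)
  qed
  then show "legendre (tangent_hat f) p \<eta> = cotangent_hat (legendre f) p \<eta>"
    by (simp add: legendre_def p\<eta>)
qed

lemma legendre_dual_hat:
  assumes "legendre_dual f (\<lambda>z \<xi>. ereal (g z \<xi>))"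
  shows "legendre_dual (tangent_hat f) (\<lambda>p \<eta>. ereal (cotangent_hat g p \<eta>))"
proof -
  have f: "\<forall>z v. 0 \<le> f z v" "(\<lambda>z \<xi>. ereal (g z \<xi>)) = legendre f" "f = legendre (\<lambda>z \<xi>. ereal (g z \<xi>))"
    using assms unfolding legendre_dual_def by blast+
  have "(\<lambda>p \<eta>. ereal (cotangent_hat g p \<eta>)) = cotangent_hat (\<lambda>z \<xi>. ereal (g z \<xi>))"
    by (auto simp: fun_eq_iff)
  also have "\<dots> = legendre (tangent_hat f)"
    unfolding legendre_tangent_hat by (rule arg_cong[OF f(2)])
  finally have 1: "(\<lambda>p \<eta>. ereal (cotangent_hat g p \<eta>)) = legendre (tangent_hat f)" .
  have 2: "tangent_hat f = legendre (\<lambda>p \<eta>. ereal (cotangent_hat g p \<eta>))"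
    unfolding legendre_cotangent_hat by (rule arg_cong[OF f(3)])
  have "\<forall>p w. 0 \<le> tangent_hat f p w" using f(1) by auto
  with 1 2 show ?thesis unfolding legendre_dual_def by (intro conjI) auto
qed

text \<open>
  The section \<open>j\<close> through \<open>p\<close> transports neighbourhoods in \<open>A\<close> to neighbourhoods in \<open>A0\<close>, so that
  the relative interiors of the effective domains correspond.
\<close>

lemma C1_within_pullback:
  fixes P :: "'b::real_normed_vector \<Rightarrow> 'c::real_normed_vector"
  assumes f0: "C1_within A0 f0" and P: "bounded_linear P" and PA: "P ` A \<subseteq> A0"
    and f: "\<And>q. q \<in> A \<Longrightarrow> f q = f0 (P q)"
    and sect: "\<And>p. p \<in> A \<Longrightarrow> \<exists>j. continuous_on UNIV j \<and> j (P p) = p \<and> (\<forall>y\<in>A0. j y \<in> A \<and> P (j y) = y)"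
  shows "C1_within A f"
proof -
  define R where "R = (\<lambda>(A :: 'b set) f. {p\<in>A. \<exists>U. open U \<and> p \<in> U \<and> (\<forall>q\<in>U \<inter> A. \<bar>f q :: ereal\<bar> \<noteq> \<infinity>)})"
  define R0 where "R0 = (\<lambda>(A :: 'c set) f. {p\<in>A. \<exists>U. open U \<and> p \<in> U \<and> (\<forall>q\<in>U \<inter> A. \<bar>f q :: ereal\<bar> \<noteq> \<infinity>)})"
  obtain D where D: "continuous_on (R0 A0 f0) D"
    "\<And>p. p \<in> R0 A0 f0 \<Longrightarrow> ((\<lambda>q. real_of_ereal (f0 q)) has_derivative blinfun_apply (D p)) (at p within A0)"
    using f0 unfolding C1_within_def Let_def R0_def by blast
  have R: "P p \<in> R0 A0 f0" if p: "p \<in> R A f" for p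
  proof -
    obtain U where U: "p \<in> A" "open U" "p \<in> U" "\<forall>q\<in>U \<inter> A. \<bar>f q\<bar> \<noteq> \<infinity>"
      using p unfolding R_def by blast
    obtain j where j: "continuous_on UNIV j" "j (P p) = p" "\<forall>y\<in>A0. j y \<in> A \<and> P (j y) = y"
      using sect[OF U(1)] by blast
    \<comment> \<open>On \<open>A0\<close>, \<open>j\<close> is a section of \<open>P\<close>, so
      \<open>f0 y = f (j y)\<close> there, and finiteness of \<open>f\<close> on \<open>U\<close>
      carries over to \<open>f0\<close>.\<close>
    have "open (j -` U)" using j(1) U(2) by (simp add: open_vimage)
    moreover have "\<bar>f0 y\<bar> \<noteq> \<infinity>" if "y \<in> j -` U \<inter> A0" for y
      using U(4)[rule_format, of "j y"] f[of "j y"] j(3)[rule_format, of y] that by auto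
    ultimately show ?thesis
      using U(1,3) PA j(2) unfolding R0_def by (intro CollectI conjI exI[of _ "j -` U"]) auto
  qed
  let ?D = "\<lambda>p. D (P p) o\<^sub>L Blinfun P"
  have "continuous_on (R A f) ?D"
    using R linear_continuous_on[OF P]
    by (intro bounded_bilinear.continuous_on[OF bounded_bilinear_blinfun_compose] continuous_on_const
        continuous_on_compose2[OF D(1), of "R A f" P]) auto
  moreover have "((\<lambda>q. real_of_ereal (f q)) has_derivative blinfun_apply (?D p)) (at p within A)"
    if p: "p \<in> R A f" for p
  proof -
    have "((\<lambda>q. real_of_ereal (f0 q)) has_derivative blinfun_apply (D (P p))) (at (P p) within P ` A)"
      using D(2)[OF R[OF p]] PA by (rule has_derivative_subset)
    moreover have "blinfun_apply (?D p) = (\<lambda>x. D (P p) (P x))"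
      by (simp add: fun_eq_iff bounded_linear_Blinfun_apply[OF P])
    ultimately
    have "((\<lambda>q. real_of_ereal (f0 (P q))) has_derivative blinfun_apply (?D p)) (at p within A)"
      using has_derivative_in_compose[OF bounded_linear_imp_has_derivative[OF P]] by (simp only:)
    then show ?thesis
      by (rule has_derivative_transform[rotated 2]) (use p f in \<open>auto simp: R_def\<close>)
  qed
  ultimately show ?thesis unfolding C1_within_def Let_def R_def by blast
qed

section \<open>Differentiability and strict convexity of the lifted potentials\<close>

lemma C1_cotangent_hat:
  assumes M: "smooth_manifold M" and g: "C1_cotangent M (\<lambda>z \<xi>. ereal (g z \<xi>))"
  shows "C1_cotangent (times_line M) (\<lambda>p \<eta>. ereal (cotangent_hat g p \<eta>))"
  unfolding C1_cotangent_def
proof (simp, intro ballI)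
  fix c assume c: "c \<in> atlas M"
  have ch: "is_chart c" by (rule smooth_manifoldD(1)[OF M c])
  \<comment> \<open>In bundle charts the lift factors through the projection that drops the line
    coordinates of both the point and the covector.\<close>
  let ?P = "\<lambda>q :: ('b \<times> real) \<times> ('b \<times> real). (fst (fst q), fst (snd q))"
  show "C1_within ((chart_image c \<times> UNIV) \<times> UNIV)
     (\<lambda>(x, \<eta>). ereal (cotangent_hat g (chart_inv (chart_times_line c) x)
        (adjoint (to_chart (times_line M) (chart_times_line c) (chart_inv (chart_times_line c) x)) \<eta>)))"
  proof (rule C1_within_pullback[where P = ?P])
    show "C1_within (chart_image c \<times> UNIV)
       (\<lambda>(x, \<eta>). ereal (g (chart_inv c x) (adjoint (to_chart M c (chart_inv c x)) \<eta>)))"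
      using g c by (simp add: C1_cotangent_def)
    show "bounded_linear ?P"
      by (intro bounded_linear_Pair bounded_linear_fst_comp bounded_linear_snd_comp bounded_linear_fst bounded_linear_snd)
  next
    fix q assume q: "q \<in> (chart_image c \<times> (UNIV :: real set)) \<times> (UNIV :: ('b \<times> real) set)"
    then obtain x a \<eta> r where q': "q = ((x, a), (\<eta>, r))" "x \<in> chart_image c" by auto
    note z = apply_chart_inv(2)[OF ch q'(2)]
    show "(case q of (x, \<eta>) \<Rightarrow> ereal (cotangent_hat g (chart_inv (chart_times_line c) x)
        (adjoint (to_chart (times_line M) (chart_times_line c) (chart_inv (chart_times_line c) x)) \<eta>))) =
      (case ?P q of (x, \<eta>) \<Rightarrow> ereal (g (chart_inv c x) (adjoint (to_chart M c (chart_inv c x)) \<eta>)))"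
      by (simp add: q'(1) chart_inv_times_line[OF ch q'(2)] to_chart_times_line[OF M c z]
          adjoint_times_line[OF linear_to_chart[OF M c z]])
    show "\<exists>j. continuous_on UNIV j \<and> j (?P q) = q \<and> (\<forall>y\<in>chart_image c \<times> UNIV.
        j y \<in> (chart_image c \<times> UNIV) \<times> UNIV \<and> ?P (j y) = y)"
      by (rule exI[of _ "\<lambda>y. ((fst y, a), (snd y, r))"]) (auto simp: q' intro!: continuous_intros)
  qed auto
qed

text \<open>On the annihilator of \<open>(0, 1)\<close>, given by \<open>s = 0\<close>, the lift is
  \<open>f\<close> itself, so the condition is pulled back from the tangent bundle of
  \<open>M\<close>.\<close>

lemma C1_tangent_hat:
  assumes M: "smooth_manifold M" and f: "C1_tangent M (\<lambda>_. {0}) f"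
  shows "C1_tangent (times_line M) (\<lambda>_. span {(0, 1)}) (tangent_hat f)"
  unfolding C1_tangent_def
proof (simp only: times_line_simps ball_simps, intro ballI)
  fix c assume c: "c \<in> atlas M"
  have ch: "is_chart c" by (rule smooth_manifoldD(1)[OF M c])
  let ?P = "\<lambda>q :: ('b \<times> real) \<times> ('b \<times> real). (fst (fst q), fst (snd q))"
  let ?A = "{(x, w). x \<in> chart_image (chart_times_line c) \<and> (\<forall>\<nu>\<in>span {(0, 1)}.
      from_chart (times_line M) (chart_times_line c) (chart_inv (chart_times_line c) x) w \<bullet> \<nu> = 0)}"
  have from_chart: "from_chart (times_line M) (chart_times_line c) (chart_inv (chart_times_line c) (x, a)) =
      (\<lambda>(v, s). (from_chart M c (chart_inv c x) v, s))" if "x \<in> chart_image c" for x a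
    using from_chart_times_line[OF M c apply_chart_inv(2)[OF ch that]]
    by (simp add: chart_inv_times_line[OF ch that])
  have A: "?A = {((x, a), (w, s)). x \<in> chart_image c \<and> s = 0}"
    by (auto simp: from_chart span_singleton inner_prod_def)
  show "C1_within ?A (\<lambda>(x, w). tangent_hat f (chart_inv (chart_times_line c) x)
      (from_chart (times_line M) (chart_times_line c) (chart_inv (chart_times_line c) x) w))"
    unfolding A
  proof (rule C1_within_pullback[where P = ?P])
    show "C1_within (chart_image c \<times> UNIV) (\<lambda>(x, w). f (chart_inv c x) (from_chart M c (chart_inv c x) w))"
    proof -
      have "chart_image c \<times> UNIV = {(x, w). x \<in> chart_image c \<and>
          (\<forall>\<nu>\<in>{0}. from_chart M c (chart_inv c x) w \<bullet> \<nu> = 0)}" by auto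
      then show ?thesis using f c unfolding C1_tangent_def by simp
    qed
    show "bounded_linear ?P"
      by (intro bounded_linear_Pair bounded_linear_fst_comp bounded_linear_snd_comp bounded_linear_fst bounded_linear_snd)
  next
    fix q :: "('b \<times> real) \<times> ('b \<times> real)"
    assume "q \<in> {((x, a), (w, s)). x \<in> chart_image c \<and> s = 0}"
    then obtain x a w where q: "q = ((x, a), (w, 0))" "x \<in> chart_image c" by auto
    show "(case q of (x, w) \<Rightarrow> tangent_hat f (chart_inv (chart_times_line c) x)
        (from_chart (times_line M) (chart_times_line c) (chart_inv (chart_times_line c) x) w)) =
      (case ?P q of (x, w) \<Rightarrow> f (chart_inv c x) (from_chart M c (chart_inv c x) w))"
      by (simp add: q(1) from_chart[OF q(2)]) (simp add: chart_inv_times_line[OF ch q(2)])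
    show "\<exists>j. continuous_on UNIV j \<and> j (?P q) = q \<and> (\<forall>y\<in>chart_image c \<times> UNIV.
        j y \<in> {((x, a), (w, s)). x \<in> chart_image c \<and> s = 0} \<and> ?P (j y) = y)"
      by (rule exI[of _ "\<lambda>y. ((fst y, a), (snd y, 0))"]) (auto simp: q intro!: continuous_intros)
  qed auto
qed

lemma dissipation_potentials_hat:
  fixes M :: "('a::{t2_space, second_countable_topology}, 'e::euclidean_space) manifold"
  assumes M: "smooth_manifold M" and d: "dissipation_potentials M f (\<lambda>z \<xi>. ereal (g z \<xi>))"
  shows "dissipation_potentials_mod (times_line M) (\<lambda>p. span {differential (times_line M) E_hat p})
    (tangent_hat f) (\<lambda>p \<eta>. ereal (cotangent_hat g p \<eta>))"
proof -
  have dE: "(\<lambda>p. span {differential (times_line M) E_hat p}) = (\<lambda>_. span {(0, 1)})"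
    by (auto simp: fun_eq_iff differential_E_hat[OF M])
  note d' = d[unfolded dissipation_potentials_def dissipation_potentials_mod_def]
  \<comment> \<open>Finite values occur only for \<open>s = 0\<close>, so segments in the effective
    domain reduce to segments for \<open>f z\<close>.\<close>
  have "strictly_convex_mod {0} (tangent_hat f p)" for p
  proof -
    obtain z a where p: "p = (z, a)" by (cases p)
    have "strictly_convex_mod {0} (f z)" using d' by blast
    then show ?thesis
      unfolding strictly_convex_mod_def p by (auto simp: zero_prod_def split: if_splits)
  qed
  \<comment> \<open>A direction outside the span of \<open>(0, 1)\<close> has a nonzero first
    component, so strict convexity of \<open>g z\<close> applies to the projected segment.\<close>
  moreover have "strictly_convex_mod (span {(0, 1)}) (\<lambda>\<eta>. ereal (cotangent_hat g p \<eta>))" for p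
  proof -
    obtain z a where p: "p = (z, a)" by (cases p)
    have "strictly_convex_mod {0} (\<lambda>\<xi>. ereal (g z \<xi>))" using d' by blast
    then show ?thesis
      unfolding strictly_convex_mod_def p span_singleton
      by (clarsimp simp: image_iff split_paired_All)
  qed
  moreover have "C1_tangent (times_line M) (\<lambda>_. span {(0, 1)}) (tangent_hat f)"
    using d' by (intro C1_tangent_hat[OF M]) blast
  moreover have "C1_cotangent (times_line M) (\<lambda>p \<eta>. ereal (cotangent_hat g p \<eta>))"
    using d' by (intro C1_cotangent_hat[OF M]) blast
  moreover have "legendre_dual (tangent_hat f) (\<lambda>p \<eta>. ereal (cotangent_hat g p \<eta>))"
    using d' by (intro legendre_dual_hat) blast
  ultimately show ?thesis
    unfolding dissipation_potentials_mod_def dE using d' by (auto simp: zero_prod_def)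
qed

section \<open>Reversibility, zero-cost flow and GENERIC structure of the lifted system\<close>

theorem theorem4p1:
  fixes M :: "('a::{t2_space, second_countable_topology}, 'e::euclidean_space) manifold"
    and S :: "'a \<Rightarrow> real"
    and W F :: "'a \<Rightarrow> 'e"
    and H1 H2 H \<Psi>s :: "'a \<Rightarrow> 'e \<Rightarrow> real"
    and \<Psi> Lag :: "'a \<Rightarrow> 'e \<Rightarrow> ereal"
    and H1_hat H2_hat H_hat \<Psi>s_hat :: "'a \<times> real \<Rightarrow> 'e \<times> real \<Rightarrow> real"
    and \<Psi>_hat Lag_hat :: "'a \<times> real \<Rightarrow> 'e \<times> real \<Rightarrow> ereal"
  assumes manifold: "smooth_manifold M"
    and S: "Ck_fun 1 M S"
    and W: "vector_field M W"
    and F: "vector_field M F"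
    and H: "\<And>z \<xi>. H z \<xi> = H1 z \<xi> + H2 z \<xi>"
    and H1: "\<And>z \<xi>. H1 z \<xi> = W z \<bullet> \<xi>"
    and \<Psi>s_nonneg: "\<And>z \<xi>. 0 \<le> \<Psi>s z \<xi>"
    and relation: "potential_relation M S \<Psi>s H2"
    and \<Psi>: "legendre_dual \<Psi> (\<lambda>z \<xi>. ereal (\<Psi>s z \<xi>))"
    and Lag: "legendre_dual Lag (\<lambda>z \<xi>. ereal (H z \<xi>))"
    and \<Psi>s_hat: "\<Psi>s_hat = cotangent_hat \<Psi>s"
    and H1_hat: "H1_hat = cotangent_hat H1"
    and H2_hat: "H2_hat = cotangent_hat H2"
    and H_hat: "\<And>p \<eta>. H_hat p \<eta> = H1_hat p \<eta> + H2_hat p \<eta>"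
    and \<Psi>_hat: "\<Psi>_hat = legendre (\<lambda>p \<eta>. ereal (\<Psi>s_hat p \<eta>))"
    and Lag_hat: "Lag_hat = legendre (\<lambda>p \<eta>. ereal (H_hat p \<eta>))"
  shows
    "(legendre_dual \<Psi>_hat (\<lambda>p \<eta>. ereal (\<Psi>s_hat p \<eta>)) \<and>
      legendre_dual Lag_hat (\<lambda>p \<eta>. ereal (H_hat p \<eta>))) \<and>
     \<comment> \<open>(i)\<close>
     potential_relation (times_line M) (S_hat S) \<Psi>s_hat H2_hat \<and>
     \<comment> \<open>(ii)\<close>
     (antisymmetric (L_hat W) \<and> jacobi_identity (times_line M) (L_hat W)) \<and>
     \<comment> \<open>(iii)\<close>
     (\<forall>z. W z \<bullet> differential M S z = 0 \<longrightarrow>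
        (\<forall>a. L_hat W (z, a) (differential (times_line M) (S_hat S) (z, a)) = 0)) \<and>
     \<comment> \<open>(a)\<close>
     ((\<forall>z. W z \<bullet> differential M S z = 0) \<and> reversible M H2 S \<and> zero_cost_flow M F Lag \<longrightarrow>
        (\<forall>p \<eta>. H1_hat p \<eta> = L_hat W p (differential (times_line M) E_hat p) \<bullet> \<eta>) \<and>
        reversible (times_line M) H2_hat (S_hat S) \<and>
        (\<forall>p. L_hat W p (differential (times_line M) (S_hat S) p) = 0) \<and>
        (\<forall>p \<eta>. (\<lambda>\<alpha>. H2_hat p (\<eta> + \<alpha> *\<^sub>R differential (times_line M) E_hat p)) constant_on UNIV) \<and>
        zero_cost_flow (times_line M) (F_hat F) Lag_hat) \<and>
     \<comment> \<open>(b)\<close>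
     (symmetric_pot \<Psi>s \<and> pre_generic M F S \<Psi> (\<lambda>z \<xi>. ereal (\<Psi>s z \<xi>)) W \<longrightarrow>
        symmetric_pot \<Psi>s_hat \<and>
        generic (times_line M) (F_hat F) (S_hat S) E_hat
          \<Psi>_hat (\<lambda>p \<eta>. ereal (\<Psi>s_hat p \<eta>)) (L_hat W))"
proof -
  let ?N = "times_line M"
  have H_hat_eq: "H_hat = cotangent_hat H"
    by (auto simp: fun_eq_iff H_hat H1_hat H2_hat H)
  \<comment> \<open>\<Psi> is itself the Legendre dual of \<open>\<Psi>s\<close>, so the dual of the
    lift is the lift of \<Psi>; the same holds for \<open>Lag\<close>.\<close>
  have \<Psi>_hat_eq: "\<Psi>_hat = tangent_hat \<Psi>"
    using \<Psi> unfolding \<Psi>_hat \<Psi>s_hat legendre_cotangent_hat legendre_dual_def by metis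
  have Lag_hat_eq: "Lag_hat = tangent_hat Lag"
    using Lag unfolding Lag_hat H_hat_eq legendre_cotangent_hat legendre_dual_def by metis
  note dS = differential_S_hat[OF manifold S]
  note dE = differential_E_hat[OF manifold]
  have anti: "L_hat W (z, a) (differential ?N (S_hat S) (z, a)) = 0" if "W z \<bullet> differential M S z = 0" for z a
    using that by (simp add: dS L_hat_def zero_prod_def)
  have jac: "jacobi_identity ?N (L_hat W)" by (rule jacobi_identity_L_hat[OF manifold W])
  have a: "(\<forall>z. W z \<bullet> differential M S z = 0) \<and> reversible M H2 S \<and> zero_cost_flow M F Lag \<longrightarrow>
      (\<forall>p \<eta>. H1_hat p \<eta> = L_hat W p (differential ?N E_hat p) \<bullet> \<eta>) \<and>
      reversible ?N H2_hat (S_hat S) \<and>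
      (\<forall>p. L_hat W p (differential ?N (S_hat S) p) = 0) \<and>
      (\<forall>p \<eta>. (\<lambda>\<alpha>. H2_hat p (\<eta> + \<alpha> *\<^sub>R differential ?N E_hat p)) constant_on UNIV) \<and>
      zero_cost_flow ?N (F_hat F) Lag_hat"
  proof (intro impI, elim conjE, intro conjI)
    assume that: "\<forall>z. W z \<bullet> differential M S z = 0" "reversible M H2 S" "zero_cost_flow M F Lag"
    show "\<forall>p \<eta>. H1_hat p \<eta> = L_hat W p (differential ?N E_hat p) \<bullet> \<eta>"
      by (auto simp: H1_hat H1 dE L_hat_def)
    show "reversible ?N H2_hat (S_hat S)"
      using that(2) Ck_fun_S_hat[OF manifold] by (auto simp: reversible_def H2_hat dS)
    show "\<forall>p. L_hat W p (differential ?N (S_hat S) p) = 0"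
      using that(1) anti by auto
    show "\<forall>p \<eta>. (\<lambda>\<alpha>. H2_hat p (\<eta> + \<alpha> *\<^sub>R differential ?N E_hat p)) constant_on UNIV"
      by (auto simp: constant_on_def H2_hat dE)
    \<comment> \<open>Since \<infinity> differs from 0, a zero of the lifted Lagrangian has line
      component 0, and its first component is a zero of \<open>Lag\<close>.\<close>
    show "zero_cost_flow ?N (F_hat F) Lag_hat"
      using that(3) vector_field_F_hat[OF manifold F]
      by (auto simp: zero_cost_flow_def Lag_hat_eq F_hat_def split: if_splits)
  qed
  have b: "symmetric_pot \<Psi>s \<and> pre_generic M F S \<Psi> (\<lambda>z \<xi>. ereal (\<Psi>s z \<xi>)) W \<longrightarrow>
      symmetric_pot \<Psi>s_hat \<and> generic ?N (F_hat F) (S_hat S) E_hat \<Psi>_hat (\<lambda>p \<eta>. ereal (\<Psi>s_hat p \<eta>)) (L_hat W)"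
  proof (intro impI, elim conjE)
    assume sym: "symmetric_pot \<Psi>s" and pre: "pre_generic M F S \<Psi> (\<lambda>z \<xi>. ereal (\<Psi>s z \<xi>)) W"
    note pre' = pre[unfolded pre_generic_def]
    have s: "symmetric_pot \<Psi>s_hat" "symmetric_pot (\<lambda>p \<eta>. ereal (\<Psi>s_hat p \<eta>))"
      using sym by (auto simp: symmetric_pot_def \<Psi>s_hat)
    moreover have "symmetric_pot \<Psi>_hat"
      using pre' by (auto simp: symmetric_pot_def \<Psi>_hat_eq)
    moreover have "dissipation_potentials_mod ?N (\<lambda>p. span {differential ?N E_hat p}) \<Psi>_hat (\<lambda>p \<eta>. ereal (\<Psi>s_hat p \<eta>))"
      unfolding \<Psi>_hat_eq \<Psi>s_hat using pre' by (intro dissipation_potentials_hat[OF manifold]) blast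
    \<comment> \<open>\<open>L_hat W\<close> sends \<open>(0, 1)\<close> to \<open>(W z, 0)\<close>,
      so the velocity argument is \<open>(F z - W z, 0)\<close>. There the lift of \<Psi> is \<Psi>,
      and the equation is the pre-GENERIC one.\<close>
    moreover have "\<Psi>_hat p (F_hat F p - L_hat W p (differential ?N E_hat p)) +
        ereal (\<Psi>s_hat p (- (1/2) *\<^sub>R differential ?N (S_hat S) p)) +
        ereal (1/2 * (F_hat F p \<bullet> differential ?N (S_hat S) p)) = 0" for p
      using pre' by (cases p) (simp add: \<Psi>_hat_eq \<Psi>s_hat dS dE F_hat_def L_hat_def)
    moreover have "\<Psi>s_hat p (\<eta> + \<alpha> *\<^sub>R differential ?N E_hat p) = \<Psi>s_hat p \<eta>" for p \<eta> \<alpha>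
      by (cases p; cases \<eta>) (simp add: \<Psi>s_hat dE)
    moreover have "L_hat W p (differential ?N (S_hat S) p) = 0" for p
      using pre' anti by (cases p) auto
    ultimately show "symmetric_pot \<Psi>s_hat \<and>
        generic ?N (F_hat F) (S_hat S) E_hat \<Psi>_hat (\<lambda>p \<eta>. ereal (\<Psi>s_hat p \<eta>)) (L_hat W)"
      unfolding generic_def
      using vector_field_F_hat[OF manifold F] Ck_fun_S_hat[OF manifold S] Ck_fun_E_hat[OF manifold]
        antisymmetric_L_hat jac by auto
  qed
  have "potential_relation ?N (S_hat S) \<Psi>s_hat H2_hat"
  proof -
    have c: "cotangent_hat K p \<eta> = K (fst p) (fst \<eta>)" for K :: "'a \<Rightarrow> 'e \<Rightarrow> real" and p \<eta>
      by (cases p; cases \<eta>) simp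
    have d: "fst (differential ?N (S_hat S) p) = differential M S (fst p)" for p
      by (cases p) (simp add: dS)
    show ?thesis
      unfolding potential_relation_def \<Psi>s_hat H2_hat c d fst_add fst_diff fst_scaleR
      by (intro conjI allI;
          rule relation[unfolded potential_relation_def, THEN conjunct1, rule_format]
            relation[unfolded potential_relation_def, THEN conjunct2, rule_format])
  qed
  moreover have "legendre_dual \<Psi>_hat (\<lambda>p \<eta>. ereal (\<Psi>s_hat p \<eta>)) \<and> legendre_dual Lag_hat (\<lambda>p \<eta>. ereal (H_hat p \<eta>))"
    unfolding \<Psi>_hat_eq Lag_hat_eq H_hat_eq \<Psi>s_hat
    by (intro conjI legendre_dual_hat \<Psi> Lag)
  moreover have "\<forall>z. W z \<bullet> differential M S z = 0 \<longrightarrow>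
      (\<forall>a. L_hat W (z, a) (differential ?N (S_hat S) (z, a)) = 0)"
    using anti by blast
  ultimately show ?thesis
    using a b conjI[OF antisymmetric_L_hat[of W] jac] by (simp only: simp_thms)
qed

end
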